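(* For every integer $d\geq 2$, there exist smooth affine algebraic varieties $X$ and $Y$ over $\mathbb{C}$ of dimension $d$ which are not isomorphic, although the cartesian products $X\times X$ and $Y\times Y$ are isomorphic.
   Context: All varieties are over the field $\mathbb{C}$ of complex numbers, and isomorphisms are isomorphisms of abstract complex algebraic varieties. *)

theory Defs
  imports
    "HOL-Library.Poly_Mapping"
    "HOL-Library.Extended_Nat"
    "Jordan_Normal_Form.VS_Connect"
begin

section \<open>Complex polynomials in the variables \<open>x\<^sub>0, x\<^sub>1, \<dots>\<close>\<close>

text \<open>A monomial maps each variable index to its exponent; a polynomial maps each monomial to
  its coefficient.\<close>

type_synonym monomial = "nat \<Rightarrow>\<^sub>0 nat"
type_synonym mpoly = "monomial \<Rightarrow>\<^sub>0 complex"

definition polys :: "nat \<Rightarrow> mpoly set" where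
  "polys n = {p. \<forall>m\<in>Poly_Mapping.keys p. Poly_Mapping.keys m \<subseteq> {..<n}}"

definition mpoly_eval :: "mpoly \<Rightarrow> complex vec \<Rightarrow> complex" where
  "mpoly_eval p x =
     (\<Sum>m\<in>Poly_Mapping.keys p.
        Poly_Mapping.lookup p m *
        (\<Prod>i\<in>Poly_Mapping.keys m. (x $ i) ^ Poly_Mapping.lookup m i))"

text \<open>Subtraction of exponents truncates at zero, but then the coefficient vanishes as well.\<close>

definition mpoly_pderiv :: "nat \<Rightarrow> mpoly \<Rightarrow> mpoly" where
  "mpoly_pderiv i p =
     (\<Sum>m\<in>Poly_Mapping.keys p.
        Poly_Mapping.single (m - Poly_Mapping.single i 1)
          (of_nat (Poly_Mapping.lookup m i) * Poly_Mapping.lookup p m))"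

section \<open>Affine varieties\<close>

text \<open>Affine varieties over \<open>\<complex>\<close> are Zariski closed subsets \<open>X\<close> of an affine space
  \<open>\<complex>\<^sup>n = carrier_vec n\<close>; the number \<open>n\<close> is carried along explicitly.\<close>

definition zero_locus :: "nat \<Rightarrow> mpoly set \<Rightarrow> complex vec set" where
  "zero_locus n S = {x \<in> carrier_vec n. \<forall>p\<in>S. mpoly_eval p x = 0}"

definition algebraic_set :: "nat \<Rightarrow> complex vec set \<Rightarrow> bool" where
  "algebraic_set n X \<longleftrightarrow> (\<exists>S \<subseteq> polys n. X = zero_locus n S)"

definition affine_variety :: "nat \<Rightarrow> complex vec set \<Rightarrow> bool" where
  "affine_variety n X \<longleftrightarrow>
     algebraic_set n X \<and> X \<noteq> {} \<and>
     (\<forall>A B. algebraic_set n A \<and> algebraic_set n B \<and> X = A \<union> B \<longrightarrow> X = A \<or> X = B)"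

definition vanishing_ideal :: "nat \<Rightarrow> complex vec set \<Rightarrow> mpoly set" where
  "vanishing_ideal n X = {p \<in> polys n. \<forall>x\<in>X. mpoly_eval p x = 0}"

text \<open>The Krull dimension of \<open>X\<close> with the Zariski topology: the supremum of the lengths \<open>r\<close>
  of chains \<open>Z\<^sub>0 \<subset> \<dots> \<subset> Z\<^sub>r\<close> of irreducible closed subsets of \<open>X\<close>.\<close>

definition variety_dim :: "nat \<Rightarrow> complex vec set \<Rightarrow> enat" where
  "variety_dim n X =
     (SUP r \<in> {r. \<exists>Z. (\<forall>i\<le>r. affine_variety n (Z i) \<and> Z i \<subseteq> X) \<and>
                     (\<forall>i<r. Z i \<subset> Z (Suc i))}. enat r)"

definition tangent_space :: "nat \<Rightarrow> complex vec set \<Rightarrow> complex vec \<Rightarrow> complex vec set" where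
  "tangent_space n X x =
     {v \<in> carrier_vec n. \<forall>p\<in>vanishing_ideal n X.
        (\<Sum>i<n. mpoly_eval (mpoly_pderiv i p) x * v $ i) = 0}"

definition tangent_dim :: "nat \<Rightarrow> complex vec set \<Rightarrow> complex vec \<Rightarrow> nat" where
  "tangent_dim n X x =
     vectorspace.dim class_ring
       ((module_vec TYPE(complex) n)\<lparr>carrier := tangent_space n X x\<rparr>)"

text \<open>The global dimension is the right one at every point because \<open>X\<close> is irreducible.\<close>

definition smooth_affine_variety :: "nat \<Rightarrow> complex vec set \<Rightarrow> bool" where
  "smooth_affine_variety n X \<longleftrightarrow>
     affine_variety n X \<and> (\<forall>x\<in>X. enat (tangent_dim n X x) = variety_dim n X)"

section \<open>Morphisms and products\<close>

definition morphism ::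
  "nat \<Rightarrow> complex vec set \<Rightarrow> nat \<Rightarrow> complex vec set \<Rightarrow> (complex vec \<Rightarrow> complex vec) \<Rightarrow> bool" where
  "morphism n X m Y f \<longleftrightarrow>
     f ` X \<subseteq> Y \<and>
     (\<exists>p. (\<forall>j<m. p j \<in> polys n) \<and> (\<forall>x\<in>X. f x = vec m (\<lambda>j. mpoly_eval (p j) x)))"

definition isomorphic :: "nat \<Rightarrow> complex vec set \<Rightarrow> nat \<Rightarrow> complex vec set \<Rightarrow> bool" where
  "isomorphic n X m Y \<longleftrightarrow>
     (\<exists>f g. morphism n X m Y f \<and> morphism m Y n X g \<and>
            (\<forall>x\<in>X. g (f x) = x) \<and> (\<forall>y\<in>Y. f (g y) = y))"

text \<open>The product of \<open>X \<subseteq> \<complex>\<^sup>n\<close> and \<open>Y \<subseteq> \<complex>\<^sup>m\<close>, as a closed subset of \<open>\<complex>\<^sup>n\<^sup>+\<^sup>m\<close>.\<close>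

definition variety_prod :: "complex vec set \<Rightarrow> complex vec set \<Rightarrow> complex vec set" where
  "variety_prod X Y = {x @\<^sub>v y | x y. x \<in> X \<and> y \<in> Y}"

end

theory Submission
  imports Defs "HOL-Computational_Algebra.Fundamental_Theorem_Algebra"
begin

text \<open>
  For \<open>a = 1, 2\<close> let \<open>X\<^sub>a\<close> be the open subset \<open>u (u\<^sup>a + x\<^sup>5) \<noteq> 0\<close> of affine \<open>d\<close>-space with
  coordinates \<open>x, u, z\<^sub>2, \<dots>, z\<^sub>d\<^sub>-\<^sub>1\<close>, embedded in \<open>(d+1)\<close>-space by the inverse \<open>s\<close> of the
  defining polynomial. The function \<open>u\<close> maps \<open>X\<^sub>a\<close> to the punctured line with fibre
  \<open>C \<times> \<complex>\<^sup>d\<^sup>-\<^sup>2\<close>, where \<open>C\<close> is the curve \<open>1 + x\<^sup>5 \<noteq> 0\<close>, and going once around the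
  puncture acts on \<open>C\<close> by the \<open>a\<close>-th power of the rotation \<open>\<sigma>\<close> of order \<open>5\<close>. So \<open>X\<^sub>1\<close> and \<open>X\<^sub>2\<close>
  are twisted products with monodromy \<open>\<sigma>\<close> and \<open>\<sigma>\<^sup>2\<close>.

  The squares fibre over a product of two punctured lines, with monodromy \<open>\<int>\<^sup>2 \<rightarrow> (\<int>/5)\<^sup>2\<close>
  given by \<open>1\<close> and \<open>2\<close> times the identity. The scalar \<open>3\<close>, the inverse of \<open>2\<close> modulo \<open>5\<close>,
  identifies the two, and since \<open>3\<^sup>2 = -1\<close> modulo \<open>5\<close> it lifts to an invertible integer matrix,
  namely \<open>(3, 5; 5, 8)\<close> of determinant \<open>-1\<close>. The monomial change of \<open>(u, u')\<close> that it describes, with a matching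
  rescaling of \<open>x\<close> and \<open>x'\<close>, is the isomorphism of squares (\<open>squares_isomorphic\<close>).

  For a single factor only \<open>\<plusminus>1\<close> is available in place of the matrix, and \<open>3 \<noteq> \<plusminus>1\<close> modulo \<open>5\<close>.
  This becomes a proof by means of units (\<open>twisted_not_isomorphic\<close>). The units of \<open>X\<^sub>1\<close> are
  \<open>c u\<^sup>i v\<^sup>j\<close> with \<open>v = u + x\<^sup>5\<close>, so an isomorphism \<open>X\<^sub>1 \<rightarrow> X\<^sub>2\<close> pulls back \<open>U\<close> and \<open>V = U\<^sup>2 + X\<^sup>5\<close> to
  such monomials, and the difference of the pullbacks of \<open>V\<close> and \<open>U\<^sup>2\<close> is a fifth power. A fifth
  power has only critical zeros, which forces the pullback of \<open>V / U\<^sup>2\<close> to be \<open>(v / u)\<^sup>\<plusminus>\<^sup>1\<close>; being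
  a fifth power then gives \<open>2 (i + j) = 1\<close> modulo \<open>5\<close> (\<open>fifth_power_difference_exponents\<close>). On the
  other hand, the cuspidal curve \<open>(X, U) = (t\<^sup>2, t\<^sup>5)\<close> in \<open>X\<^sub>2\<close> shows that \<open>i + j\<close> divides \<open>5\<close>.
  No divisor of \<open>5\<close> satisfies that congruence.

  Smoothness and dimension hold for every nonempty principal open subset of affine space
  (\<open>smooth_principal_open\<close>). The upper bound for the Krull dimension comes from algebraic
  independence: a chain of length \<open>r\<close> yields \<open>r\<close> algebraically independent functions, and counting
  monomials against the size of an interpolation grid shows \<open>r \<le> d\<close>.
\<close>

section \<open>Polynomial functions\<close>

text \<open>Working with polynomial functions of a coordinate sequence, generated inductively, turns closure
  properties into inductions over four cases; the passage to and from formal polynomials is made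
  once, in \<open>polyfun_of_mpoly\<close> and \<open>mpoly_of_polyfun\<close>.\<close>

inductive polyfun :: "nat \<Rightarrow> ((nat \<Rightarrow> complex) \<Rightarrow> complex) \<Rightarrow> bool" for n where
  const: "polyfun n (\<lambda>_. c)"
| coord: "i < n \<Longrightarrow> polyfun n (\<lambda>y. y i)"
| add: "polyfun n f \<Longrightarrow> polyfun n g \<Longrightarrow> polyfun n (\<lambda>y. f y + g y)"
| mult: "polyfun n f \<Longrightarrow> polyfun n g \<Longrightarrow> polyfun n (\<lambda>y. f y * g y)"

lemma polyfun_diff: "polyfun n f \<Longrightarrow> polyfun n g \<Longrightarrow> polyfun n (\<lambda>y. f y - g y)"
  using polyfun.add[OF _ polyfun.mult[OF polyfun.const[of n "-1"]], of f g] by simp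

lemma polyfun_power: "polyfun n f \<Longrightarrow> polyfun n (\<lambda>y. f y ^ k)"
  by (induction k) (auto intro: polyfun.intros)

lemma polyfun_sum: "(\<And>a. a \<in> A \<Longrightarrow> polyfun n (f a)) \<Longrightarrow> polyfun n (\<lambda>y. \<Sum>a\<in>A. f a y)"
  by (induction A rule: infinite_finite_induct) (auto intro: polyfun.intros)

lemma polyfun_prod: "(\<And>a. a \<in> A \<Longrightarrow> polyfun n (f a)) \<Longrightarrow> polyfun n (\<lambda>y. \<Prod>a\<in>A. f a y)"
  by (induction A rule: infinite_finite_induct) (auto intro: polyfun.intros)

lemmas polyfun_intros = polyfun.intros polyfun_diff polyfun_power polyfun_sum polyfun_prod

lemma polyfun_cong_arg:
  assumes "polyfun n f" "\<And>i. i < n \<Longrightarrow> y i = y' i"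
  shows "f y = f y'"
  using assms by induction auto

lemma polyfun_subst:
  assumes "polyfun n f" "\<And>i. i < n \<Longrightarrow> polyfun m (\<lambda>y. g y i)"
  shows "polyfun m (\<lambda>y. f (g y))"
  using assms by induction (auto intro: polyfun.intros)

lemma polyfun_mono: "polyfun n f \<Longrightarrow> n \<le> m \<Longrightarrow> polyfun m f"
  by (induction rule: polyfun.induct) (auto intro: polyfun.intros)

definition monom_eval :: "monomial \<Rightarrow> complex vec \<Rightarrow> complex" where
  "monom_eval m x = (\<Prod>i\<in>Poly_Mapping.keys m. (x $ i) ^ Poly_Mapping.lookup m i)"

lemma monom_eval_superset:
  assumes "finite A" "Poly_Mapping.keys m \<subseteq> A"
  shows "monom_eval m x = (\<Prod>i\<in>A. (x $ i) ^ Poly_Mapping.lookup m i)"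
  unfolding monom_eval_def
  by (rule prod.mono_neutral_left[OF assms]) (auto simp: in_keys_iff)

lemma monom_eval_add: "monom_eval (m + m') x = monom_eval m x * monom_eval m' x"
proof -
  let ?A = "Poly_Mapping.keys m \<union> Poly_Mapping.keys m'"
  have "monom_eval (m + m') x = (\<Prod>i\<in>?A. (x $ i) ^ Poly_Mapping.lookup (m + m') i)"
    by (rule monom_eval_superset) (use keys_add[of m m'] in auto)
  also have "\<dots> = (\<Prod>i\<in>?A. (x $ i) ^ Poly_Mapping.lookup m i)
                   * (\<Prod>i\<in>?A. (x $ i) ^ Poly_Mapping.lookup m' i)"
    by (simp add: lookup_add power_add prod.distrib)
  also have "\<dots> = monom_eval m x * monom_eval m' x"
    by (subst (1 2) monom_eval_superset[of ?A]) auto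
  finally show ?thesis .
qed

lemma mpoly_eval_altdef:
  "mpoly_eval p x = (\<Sum>m\<in>Poly_Mapping.keys p. Poly_Mapping.lookup p m * monom_eval m x)"
  by (simp add: mpoly_eval_def monom_eval_def)

lemma mpoly_eval_zero [simp]: "mpoly_eval 0 x = 0"
  by (simp add: mpoly_eval_altdef)

lemma mpoly_eval_single [simp]: "mpoly_eval (Poly_Mapping.single m c) x = c * monom_eval m x"
  by (simp add: mpoly_eval_altdef)

lemma mpoly_eval_add: "mpoly_eval (p + q) x = mpoly_eval p x + mpoly_eval q x"
  unfolding mpoly_eval_altdef
  by (rule setsum_keys_plus_distrib[where f = "\<lambda>m c. c * monom_eval m x"])
     (auto simp: algebra_simps)

lemma mpoly_eval_sum: "mpoly_eval (\<Sum>a\<in>A. f a) x = (\<Sum>a\<in>A. mpoly_eval (f a) x)"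
  by (induction A rule: infinite_finite_induct) (auto simp: mpoly_eval_add)

lemma mpoly_as_sum_of_terms:
  "p = (\<Sum>m\<in>Poly_Mapping.keys p. Poly_Mapping.single m (Poly_Mapping.lookup p m))"
  by (rule poly_mapping_eqI)
     (auto simp: lookup_sum lookup_single when_def in_keys_iff)

lemma mpoly_eval_mult: "mpoly_eval (p * q) x = mpoly_eval p x * mpoly_eval q x"
proof -
  let ?t = "\<lambda>p m. Poly_Mapping.single m (Poly_Mapping.lookup p m)"
  have "p * q = (\<Sum>m\<in>Poly_Mapping.keys p. \<Sum>m'\<in>Poly_Mapping.keys q. ?t p m * ?t q m')"
    using arg_cong2[OF mpoly_as_sum_of_terms[of p] mpoly_as_sum_of_terms[of q], of "(*)"]
    by (simp only: sum_product)
  hence "mpoly_eval (p * q) x =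
      (\<Sum>m\<in>Poly_Mapping.keys p. \<Sum>m'\<in>Poly_Mapping.keys q. mpoly_eval (?t p m * ?t q m') x)"
    by (simp only: mpoly_eval_sum)
  also have "\<dots> = mpoly_eval p x * mpoly_eval q x"
    by (simp add: mult_single monom_eval_add mpoly_eval_altdef[of p] mpoly_eval_altdef[of q]
        sum_product mult_ac)
  finally show ?thesis .
qed

lemma polys_add: "p \<in> polys n \<Longrightarrow> q \<in> polys n \<Longrightarrow> p + q \<in> polys n"
  using keys_add[of p q] unfolding polys_def by fast

lemma polys_mult:
  assumes "p \<in> polys n" "q \<in> polys n"
  shows "p * q \<in> polys n"
  unfolding polys_def
proof safe
  fix m i assume "m \<in> Poly_Mapping.keys (p * q)" and i: "i \<in> Poly_Mapping.keys m"
  then obtain a b where "m = a + b" "a \<in> Poly_Mapping.keys p" "b \<in> Poly_Mapping.keys q"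
    using keys_mult[of p q] by fast
  thus "i < n" using assms i keys_add[of a b] unfolding polys_def by blast
qed

lemma polyfun_of_mpoly:
  assumes "p \<in> polys n"
  shows "polyfun n (\<lambda>y. mpoly_eval p (vec n y))"
proof -
  have *: "i < n" if "m \<in> Poly_Mapping.keys p" "i \<in> Poly_Mapping.keys m" for i m
    using that assms unfolding polys_def by auto
  have "polyfun n (\<lambda>y. \<Sum>m\<in>Poly_Mapping.keys p. Poly_Mapping.lookup p m *
                 (\<Prod>i\<in>Poly_Mapping.keys m. y i ^ Poly_Mapping.lookup m i))"
    by (intro polyfun_intros) (use * in auto)
  also have "(\<lambda>y. \<Sum>m\<in>Poly_Mapping.keys p. Poly_Mapping.lookup p m *
                 (\<Prod>i\<in>Poly_Mapping.keys m. y i ^ Poly_Mapping.lookup m i)) =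
             (\<lambda>y. mpoly_eval p (vec n y))"
    unfolding mpoly_eval_def by (intro ext sum.cong prod.cong refl arg_cong2[of _ _ _ _ "(*)"]) (use * in auto)
  finally show ?thesis .
qed

lemma vec_vec_index [simp]: "x \<in> carrier_vec n \<Longrightarrow> vec n (($) x) = x"
  by auto

lemma mpoly_of_polyfun:
  assumes "polyfun n f"
  shows "\<exists>p\<in>polys n. \<forall>x. mpoly_eval p x = f (($) x)"
  using assms
proof induction
  case (const c)
  show ?case
    by (rule bexI[of _ "Poly_Mapping.single 0 c"]) (auto simp: polys_def monom_eval_def)
next
  case (coord i)
  thus ?case
    by (intro bexI[of _ "Poly_Mapping.single (Poly_Mapping.single i 1) 1"])
       (auto simp: polys_def monom_eval_def)
next
  case (add f g)
  thus ?case by (metis mpoly_eval_add polys_add)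
next
  case (mult f g)
  thus ?case by (metis mpoly_eval_mult polys_mult)
qed

section \<open>Irreducible closed sets in terms of polynomial functions\<close>

lemma algebraic_set_polyfun_zeros:
  assumes "\<And>f. f \<in> F \<Longrightarrow> polyfun n f"
  shows "algebraic_set n {x \<in> carrier_vec n. \<forall>f\<in>F. f (($) x) = 0}"
proof -
  let ?S = "{p \<in> polys n. \<exists>f\<in>F. \<forall>x. mpoly_eval p x = f (($) x)}"
  have "{x \<in> carrier_vec n. \<forall>f\<in>F. f (($) x) = 0} = zero_locus n ?S"
  proof safe
    fix x assume "x \<in> carrier_vec n" "\<forall>f\<in>F. f (($) x) = 0"
    thus "x \<in> zero_locus n ?S" by (auto simp: zero_locus_def)
  next
    fix x f assume x: "x \<in> zero_locus n ?S" and f: "f \<in> F"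
    obtain p where "p \<in> polys n" "\<forall>x. mpoly_eval p x = f (($) x)"
      using mpoly_of_polyfun[OF assms[OF f]] by blast
    thus "f (($) x) = 0" using x f unfolding zero_locus_def by force
  qed (auto simp: zero_locus_def)
  thus ?thesis unfolding algebraic_set_def by (intro exI[of _ ?S]) auto
qed

lemma algebraic_set_as_polyfun_zeros:
  assumes "algebraic_set n X"
  obtains F where "\<forall>f\<in>F. polyfun n f" "X = {x \<in> carrier_vec n. \<forall>f\<in>F. f (($) x) = 0}"
proof -
  obtain S where S: "S \<subseteq> polys n" "X = zero_locus n S"
    using assms unfolding algebraic_set_def by blast
  let ?F = "(\<lambda>p y. mpoly_eval p (vec n y)) ` S"
  show ?thesis
    by (rule that[of ?F]) (use S in \<open>auto simp: zero_locus_def intro: polyfun_of_mpoly\<close>)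
qed

lemma irreducible_polyfun_mult_zero:
  assumes X: "affine_variety n X" and f: "polyfun n f" and g: "polyfun n g"
    and fg: "\<And>x. x \<in> X \<Longrightarrow> f (($) x) * g (($) x) = 0"
  shows "(\<forall>x\<in>X. f (($) x) = 0) \<or> (\<forall>x\<in>X. g (($) x) = 0)"
proof -
  have "algebraic_set n X" using X by (simp add: affine_variety_def)
  then obtain F where F: "\<forall>f\<in>F. polyfun n f" "X = {x \<in> carrier_vec n. \<forall>f\<in>F. f (($) x) = 0}"
    by (rule algebraic_set_as_polyfun_zeros)
  have alg: "algebraic_set n {x \<in> X. e (($) x) = 0}" if e: "polyfun n e" for e
  proof -
    have "{x \<in> X. e (($) x) = 0} = {x \<in> carrier_vec n. \<forall>f\<in>insert e F. f (($) x) = 0}"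
      by (auto simp: F(2))
    thus ?thesis using algebraic_set_polyfun_zeros[of "insert e F" n] F(1) e by auto
  qed
  have "X = {x \<in> X. f (($) x) = 0} \<union> {x \<in> X. g (($) x) = 0}"
    using fg by auto
  hence "X = {x \<in> X. f (($) x) = 0} \<or> X = {x \<in> X. g (($) x) = 0}"
    using X alg[OF f] alg[OF g] unfolding affine_variety_def by blast
  thus ?thesis by blast
qed

lemma polyfun_on_curve:
  assumes "polyfun n f"
  shows "\<exists>q. \<forall>t. f (\<lambda>i. poly (r i) t) = poly q t"
  using assms
proof induction
  case (const c)
  show ?case by (intro exI[of _ "[:c:]"]) auto
next
  case (add f g)
  thus ?case by (metis poly_add)
next
  case (mult f g)
  thus ?case by (metis poly_mult)
qed blast

lemma polyfun_on_line:
  assumes "polyfun n f"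
  shows "\<exists>q. \<forall>t. f (\<lambda>i. a i + t * b i) = poly q t"
  using polyfun_on_curve[OF assms, of "\<lambda>i. [:a i, b i:]"] by simp

section \<open>Principal open sets\<close>

text \<open>The open set \<open>h \<noteq> 0\<close> of \<open>d\<close>-space as a closed subset of \<open>(d+1)\<close>-space: the last coordinate is
  the inverse of \<open>h\<close>. The point over \<open>y\<close> is \<open>open_pt d h y\<close>.\<close>

definition principal_open :: "nat \<Rightarrow> ((nat \<Rightarrow> complex) \<Rightarrow> complex) \<Rightarrow> complex vec set" where
  "principal_open d h = {x \<in> carrier_vec (Suc d). h (($) x) * x $ d = 1}"

definition open_pt :: "nat \<Rightarrow> ((nat \<Rightarrow> complex) \<Rightarrow> complex) \<Rightarrow> (nat \<Rightarrow> complex) \<Rightarrow> complex vec" where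
  "open_pt d h y = vec (Suc d) (\<lambda>i. if i < d then y i else 1 / h y)"

lemma open_pt_index [simp]:
  "i < d \<Longrightarrow> open_pt d h y $ i = y i" "open_pt d h y $ d = 1 / h y"
  by (auto simp: open_pt_def)

lemma open_pt_carrier [simp, intro]: "open_pt d h y \<in> carrier_vec (Suc d)"
  by (simp add: open_pt_def)

lemma polyfun_open_pt: "polyfun d f \<Longrightarrow> f (($) (open_pt d h y)) = f y"
  by (rule polyfun_cong_arg) auto

lemma open_pt_in_principal_open:
  "polyfun d h \<Longrightarrow> h y \<noteq> 0 \<Longrightarrow> open_pt d h y \<in> principal_open d h"
  by (auto simp: principal_open_def polyfun_open_pt)

lemma principal_openE:
  assumes "x \<in> principal_open d h"
  obtains "h (($) x) \<noteq> 0" "x = open_pt d h (($) x)"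
proof
  have *: "x \<in> carrier_vec (Suc d)" "h (($) x) * x $ d = 1"
    using assms by (auto simp: principal_open_def)
  thus "h (($) x) \<noteq> 0" by auto
  show "x = open_pt d h (($) x)"
    by (rule eq_vecI) (use * in \<open>auto simp: open_pt_def less_Suc_eq eq_divide_eq mult.commute\<close>)
qed

text \<open>This reduces every question about regular functions on a principal open set to honest
  polynomials in \<open>d\<close> variables.\<close>

lemma clear_denominators:
  assumes f: "polyfun (Suc d) f" and h: "polyfun d h"
  obtains N g where "polyfun d g"
    "\<And>y. h y \<noteq> 0 \<Longrightarrow> f (($) (open_pt d h y)) * h y ^ N = g y"
proof -
  from f have "\<exists>N g. polyfun d g \<and> (\<forall>y. h y \<noteq> 0 \<longrightarrow> f (($) (open_pt d h y)) * h y ^ N = g y)"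
  proof induction
    case (const c)
    show ?case by (intro exI[of _ 0] exI[of _ "\<lambda>_. c"]) (auto intro: polyfun_intros)
  next
    case (coord i)
    show ?case
    proof (cases "i < d")
      case True
      thus ?thesis by (intro exI[of _ 0] exI[of _ "\<lambda>y. y i"]) (auto intro: polyfun_intros)
    next
      case False
      hence "i = d" using coord by simp
      thus ?thesis by (intro exI[of _ 1] exI[of _ "\<lambda>_. 1"]) (auto intro: polyfun_intros)
    qed
  next
    case (add f1 f2)
    then obtain N1 g1 N2 g2 where *: "polyfun d g1" "polyfun d g2"
      "\<forall>y. h y \<noteq> 0 \<longrightarrow> f1 (($) (open_pt d h y)) * h y ^ N1 = g1 y"
      "\<forall>y. h y \<noteq> 0 \<longrightarrow> f2 (($) (open_pt d h y)) * h y ^ N2 = g2 y" by blast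
    show ?case
    proof (intro exI conjI allI impI)
      show "polyfun d (\<lambda>y. g1 y * h y ^ N2 + g2 y * h y ^ N1)"
        by (intro polyfun_intros * h)
      fix y assume "h y \<noteq> 0"
      show "(f1 (($) (open_pt d h y)) + f2 (($) (open_pt d h y))) * h y ^ (N1 + N2)
            = g1 y * h y ^ N2 + g2 y * h y ^ N1"
        using *(3,4)[rule_format, OF \<open>h y \<noteq> 0\<close>, symmetric]
        by (simp add: algebra_simps power_add)
    qed
  next
    case (mult f1 f2)
    then obtain N1 g1 N2 g2 where *: "polyfun d g1" "polyfun d g2"
      "\<forall>y. h y \<noteq> 0 \<longrightarrow> f1 (($) (open_pt d h y)) * h y ^ N1 = g1 y"
      "\<forall>y. h y \<noteq> 0 \<longrightarrow> f2 (($) (open_pt d h y)) * h y ^ N2 = g2 y" by blast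
    show ?case
    proof (intro exI conjI allI impI)
      show "polyfun d (\<lambda>y. g1 y * g2 y)" by (intro polyfun_intros * h)
      fix y assume "h y \<noteq> 0"
      show "(f1 (($) (open_pt d h y)) * f2 (($) (open_pt d h y))) * h y ^ (N1 + N2)
            = g1 y * g2 y"
        using *(3,4)[rule_format, OF \<open>h y \<noteq> 0\<close>, symmetric]
        by (simp add: algebra_simps power_add)
    qed
  qed
  thus ?thesis using that by blast
qed

lemma polyfun_nonzero_mult:
  assumes "polyfun n f" "polyfun n g" "f a \<noteq> 0" "g b \<noteq> 0"
  shows "\<exists>t. f (\<lambda>i. a i + t * (b i - a i)) \<noteq> 0 \<and> g (\<lambda>i. a i + t * (b i - a i)) \<noteq> 0"
proof -
  let ?y = "\<lambda>t i. a i + t * (b i - a i)"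
  obtain p where p: "\<And>t. f (?y t) = poly p t"
    using polyfun_on_line[OF assms(1), of a "\<lambda>i. b i - a i"] by blast
  obtain q where q: "\<And>t. g (?y t) = poly q t"
    using polyfun_on_line[OF assms(2), of a "\<lambda>i. b i - a i"] by blast
  have "poly p 0 \<noteq> 0" "poly q 1 \<noteq> 0"
    using p[of 0] q[of 1] assms(3,4) by auto
  hence "p * q \<noteq> 0" by auto
  then obtain t where "poly (p * q) t \<noteq> 0" using poly_all_0_iff_0 by blast
  thus ?thesis by (intro exI[of _ t]) (auto simp: p q)
qed

text \<open>Irreducibility comes from lines: if neither closed part of a cover were everything, a line
  through a point missed by each part would carry nonzero univariate polynomials whose product
  vanishes.\<close>

lemma affine_variety_principal_open_slice:
  assumes h: "polyfun d h" and ne: "y0 \<in> L" "h y0 \<noteq> 0"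
    and lines: "\<And>a b t. a \<in> L \<Longrightarrow> b \<in> L \<Longrightarrow> (\<lambda>i. a i + t * (b i - a i)) \<in> L"
    and alg: "algebraic_set (Suc d) (open_pt d h ` {y \<in> L. h y \<noteq> 0})"
  shows "affine_variety (Suc d) (open_pt d h ` {y \<in> L. h y \<noteq> 0})"
proof -
  let ?Z = "open_pt d h ` {y \<in> L. h y \<noteq> 0}"
  have sep: "\<exists>g. polyfun d g \<and> g a \<noteq> 0 \<and> h a \<noteq> 0 \<and> a \<in> L \<and>
                (\<forall>y. h y \<noteq> 0 \<longrightarrow> open_pt d h y \<in> A \<longrightarrow> g y = 0)"
    if A: "algebraic_set (Suc d) A" and a: "a \<in> L" "h a \<noteq> 0" "open_pt d h a \<notin> A" for A a
  proof -
    obtain F where F: "\<forall>f\<in>F. polyfun (Suc d) f"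
        "A = {x \<in> carrier_vec (Suc d). \<forall>f\<in>F. f (($) x) = 0}"
      by (rule algebraic_set_as_polyfun_zeros[OF A])
    obtain f where f: "f \<in> F" "f (($) (open_pt d h a)) \<noteq> 0" using a F(2) by auto
    obtain N g where g: "polyfun d g" "\<And>y. h y \<noteq> 0 \<Longrightarrow> f (($) (open_pt d h y)) * h y ^ N = g y"
      using clear_denominators[OF F(1)[rule_format, OF f(1)] h] by blast
    have "g y = 0" if "h y \<noteq> 0" "open_pt d h y \<in> A" for y
      using g(2)[OF that(1)] that(2) f(1) F(2) by auto
    moreover have "g a \<noteq> 0" using g(2)[OF a(2)] f(2) a(2) by auto
    ultimately show ?thesis using g(1) a by blast
  qed
  have "?Z = A \<or> ?Z = B"
    if AB: "algebraic_set (Suc d) A" "algebraic_set (Suc d) B" "?Z = A \<union> B" for A B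
  proof (rule ccontr)
    assume "\<not> (?Z = A \<or> ?Z = B)"
    then obtain a b where "a \<in> L" "h a \<noteq> 0" "open_pt d h a \<notin> A" "b \<in> L" "h b \<noteq> 0" "open_pt d h b \<notin> B"
      using AB(3) by blast
    then obtain f g where f: "polyfun d f" "f a \<noteq> 0" "h a \<noteq> 0" "a \<in> L"
        "\<And>y. h y \<noteq> 0 \<Longrightarrow> open_pt d h y \<in> A \<Longrightarrow> f y = 0"
      and g: "polyfun d g" "g b \<noteq> 0" "h b \<noteq> 0" "b \<in> L"
        "\<And>y. h y \<noteq> 0 \<Longrightarrow> open_pt d h y \<in> B \<Longrightarrow> g y = 0"
      using sep AB(1,2) by metis
    obtain t where t: "f (\<lambda>i. a i + t * (b i - a i)) * h (\<lambda>i. a i + t * (b i - a i)) \<noteq> 0"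
        "g (\<lambda>i. a i + t * (b i - a i)) \<noteq> 0"
      using polyfun_nonzero_mult[OF polyfun.mult[OF f(1) h] g(1), of a b] f g by auto
    let ?y = "\<lambda>i. a i + t * (b i - a i)"
    have "open_pt d h ?y \<in> ?Z" using lines[OF f(4) g(4)] t by auto
    thus False using t f(5)[of ?y] g(5)[of ?y] AB(3) by auto
  qed
  thus ?thesis unfolding affine_variety_def using alg ne by blast
qed

lemma principal_open_slice_eq:
  assumes h: "polyfun d h"
  shows "open_pt d h ` {y \<in> {y. \<forall>j\<in>{i..<d}. y j = c j}. h y \<noteq> 0} =
     {x \<in> principal_open d h. \<forall>j\<in>{i..<d}. x $ j = c j}"
proof safe
  fix x assume x: "x \<in> principal_open d h" "\<forall>j\<in>{i..<d}. x $ j = c j"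
  show "x \<in> open_pt d h ` {y \<in> {y. \<forall>j\<in>{i..<d}. y j = c j}. h y \<noteq> 0}"
    by (rule principal_openE[OF x(1)], rule image_eqI[of _ _ "($) x"]) (use x in simp_all)
qed (auto simp: open_pt_in_principal_open h)

lemma affine_variety_coordinate_slice:
  assumes h: "polyfun d h" and c: "h c \<noteq> 0"
  shows "affine_variety (Suc d) {x \<in> principal_open d h. \<forall>j\<in>{i..<d}. x $ j = c j}"
proof -
  let ?L = "{y. \<forall>j\<in>{i..<d}. y j = c j}"
  let ?F = "insert (\<lambda>y. h y * y d - 1) ((\<lambda>j y. y j - c j) ` {i..<d})"
  have "{x \<in> principal_open d h. \<forall>j\<in>{i..<d}. x $ j = c j}
      = {x \<in> carrier_vec (Suc d). \<forall>f\<in>?F. f (($) x) = 0}"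
    by (auto simp: principal_open_def)
  moreover have "polyfun (Suc d) f" if "f \<in> ?F" for f
    using that polyfun_mono[OF h, of "Suc d"] by (auto intro!: polyfun_intros)
  ultimately have "algebraic_set (Suc d) {x \<in> principal_open d h. \<forall>j\<in>{i..<d}. x $ j = c j}"
    using algebraic_set_polyfun_zeros[of ?F "Suc d"] by simp
  thus ?thesis
    unfolding principal_open_slice_eq[OF h, symmetric]
    by (intro affine_variety_principal_open_slice[OF h _ c]) auto
qed

text \<open>Freeing one coordinate after the other gives a chain of slices of length \<open>d\<close>. It is strict
  because \<open>h\<close> has only finitely many zeros on a line through \<open>c\<close>.\<close>

lemma variety_dim_principal_open_ge:
  assumes h: "polyfun d h" and c: "h c \<noteq> 0"
  shows "enat d \<le> variety_dim (Suc d) (principal_open d h)"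
proof -
  let ?Z = "\<lambda>i. {x \<in> principal_open d h. \<forall>j\<in>{i..<d}. x $ j = c j}"
  have "?Z i \<subset> ?Z (Suc i)" if i: "i < d" for i
  proof -
    obtain q where q: "\<And>t. h (\<lambda>j. c j + t * (if j = i then 1 else 0)) = poly q t"
      using polyfun_on_line[OF h, of c "\<lambda>j. if j = i then 1 else 0"] by blast
    have "q \<noteq> 0" using q[of 0] c by auto
    hence "finite (insert 0 {t. poly q t = 0})" using poly_roots_finite by auto
    then obtain t where t: "t \<notin> insert 0 {t. poly q t = 0}"
      using ex_new_if_finite[OF infinite_UNIV_char_0] by blast
    let ?y = "\<lambda>j. c j + t * (if j = i then 1 else 0)"
    have "open_pt d h ?y \<in> ?Z (Suc i)"
      using t by (auto intro!: open_pt_in_principal_open h simp: q)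
    moreover have "open_pt d h ?y \<notin> ?Z i" using t i by auto
    moreover have "?Z i \<subseteq> ?Z (Suc i)" by auto
    ultimately show ?thesis by blast
  qed
  thus ?thesis
    unfolding variety_dim_def
    by (intro SUP_upper CollectI exI[of _ ?Z]) (auto intro: affine_variety_coordinate_slice[OF h c])
qed

lemma affine_variety_principal_open:
  assumes "polyfun d h" "h c \<noteq> 0"
  shows "affine_variety (Suc d) (principal_open d h)"
  using affine_variety_coordinate_slice[OF assms, of d] by simp

section \<open>Polynomials vanishing on a grid\<close>

text \<open>A bound for the degree in each variable separately, read off from the restrictions to coordinate
  lines. With this bound a polynomial is determined by its values on a grid, so that the space of
  such polynomials has at most as many dimensions as the grid has points.\<close>

definition separate_degree_le :: "nat \<Rightarrow> ((nat \<Rightarrow> complex) \<Rightarrow> complex) \<Rightarrow> nat \<Rightarrow> bool" where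
  "separate_degree_le d f D \<longleftrightarrow>
     (\<forall>i<d. \<forall>y. \<exists>q. degree q \<le> D \<and> (\<forall>t. f (y(i := t)) = poly q t))"

lemma separate_degree_le_mono: "separate_degree_le d f D \<Longrightarrow> D \<le> E \<Longrightarrow> separate_degree_le d f E"
  unfolding separate_degree_le_def by (meson order_trans)

lemma separate_degree_le_const: "separate_degree_le d (\<lambda>_. c) D"
  unfolding separate_degree_le_def by (intro allI impI exI[of _ "[:c:]"]) auto

lemma separate_degree_le_add:
  assumes "separate_degree_le d f D" "separate_degree_le d g D"
  shows "separate_degree_le d (\<lambda>y. f y + g y) D"
  unfolding separate_degree_le_def
proof (intro allI impI)
  fix i y assume "i < d"
  then obtain p q where "degree p \<le> D" "\<forall>t. f (y(i := t)) = poly p t"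
    "degree q \<le> D" "\<forall>t. g (y(i := t)) = poly q t"
    using assms unfolding separate_degree_le_def by meson
  thus "\<exists>q. degree q \<le> D \<and> (\<forall>t. f (y(i := t)) + g (y(i := t)) = poly q t)"
    by (intro exI[of _ "p + q"]) (auto intro: degree_add_le)
qed

lemma separate_degree_le_mult:
  assumes "separate_degree_le d f D" "separate_degree_le d g E"
  shows "separate_degree_le d (\<lambda>y. f y * g y) (D + E)"
  unfolding separate_degree_le_def
proof (intro allI impI)
  fix i y assume "i < d"
  then obtain p q where "degree p \<le> D" "\<forall>t. f (y(i := t)) = poly p t"
    "degree q \<le> E" "\<forall>t. g (y(i := t)) = poly q t"
    using assms unfolding separate_degree_le_def by meson
  thus "\<exists>q. degree q \<le> D + E \<and> (\<forall>t. f (y(i := t)) * g (y(i := t)) = poly q t)"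
    by (intro exI[of _ "p * q"]) (auto intro: order_trans[OF degree_mult_le])
qed

lemma separate_degree_le_sum:
  "(\<And>a. a \<in> A \<Longrightarrow> separate_degree_le d (f a) D) \<Longrightarrow> separate_degree_le d (\<lambda>y. \<Sum>a\<in>A. f a y) D"
  by (induction A rule: infinite_finite_induct)
     (auto intro: separate_degree_le_add separate_degree_le_const)

lemma separate_degree_le_power:
  "separate_degree_le d f D \<Longrightarrow> separate_degree_le d (\<lambda>y. f y ^ k) (k * D)"
  by (induction k) (auto intro: separate_degree_le_mult separate_degree_le_const)

lemma separate_degree_le_prod:
  "(\<And>a. a \<in> A \<Longrightarrow> separate_degree_le d (f a) D) \<Longrightarrow>
     separate_degree_le d (\<lambda>y. \<Prod>a\<in>A. f a y) (card A * D)"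
  by (induction A rule: infinite_finite_induct)
     (auto intro: separate_degree_le_mult separate_degree_le_const)

lemma separate_degree_le_coord:
  assumes "D \<ge> 1" shows "separate_degree_le d (\<lambda>y. y j) D"
  unfolding separate_degree_le_def
proof (intro allI impI)
  fix i and y :: "nat \<Rightarrow> complex"
  show "\<exists>q. degree q \<le> D \<and> (\<forall>t. (y(i := t)) j = poly q t)"
    by (cases "i = j") (use assms in \<open>auto intro: exI[of _ "[:0, 1:]"] exI[of _ "[:y j:]"]\<close>)
qed

lemma polyfun_separate_degree_le:
  assumes "polyfun d f"
  shows "\<exists>D. separate_degree_le d f D"
  using assms
proof induction
  case (add f g)
  then obtain D E where "separate_degree_le d f D" "separate_degree_le d g E" by blast
  thus ?case
    by (intro exI[of _ "max D E"] separate_degree_le_add) (auto elim: separate_degree_le_mono)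
qed (auto intro: separate_degree_le_const separate_degree_le_coord[of 1] separate_degree_le_mult)

lemma zero_on_grid_imp_zero:
  assumes f: "polyfun d f" and D: "separate_degree_le d f D"
    and grid: "\<And>y. y \<in> PiE {..<d} (\<lambda>_. of_nat ` {..D}) \<Longrightarrow> f y = 0"
  shows "f y = 0"
proof -
  have "f y = 0" if "k \<le> d" "\<And>i. k \<le> i \<Longrightarrow> i < d \<Longrightarrow> y i \<in> of_nat ` {..D}" for k y
    using that
  proof (induction k arbitrary: y)
    case 0
    have "f y = f (restrict y {..<d})" by (rule polyfun_cong_arg[OF f]) auto
    also have "\<dots> = 0" by (rule grid) (use 0 in auto)
    finally show ?case .
  next
    case (Suc k)
    obtain q where q: "degree q \<le> D" "\<And>t. f (y(k := t)) = poly q t"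
      using D Suc.prems(1) unfolding separate_degree_le_def by (meson Suc_le_lessD)
    have root: "poly q t = 0" if "t \<in> of_nat ` {..D}" for t
      unfolding q(2)[symmetric]
    proof (rule Suc.IH)
      show "(y(k := t)) i \<in> of_nat ` {..D}" if "k \<le> i" "i < d" for i
        using Suc.prems(2)[of i] that \<open>t \<in> _\<close> by (cases "i = k") (simp_all add: Suc_le_eq)
    qed (use Suc.prems in simp)
    have "q = 0"
    proof (rule ccontr)
      assume "q \<noteq> 0"
      hence "card ((of_nat :: nat \<Rightarrow> complex) ` {..D}) \<le> card {t. poly q t = 0}"
        by (intro card_mono poly_roots_finite) (use root in auto)
      also have "\<dots> \<le> D" using card_poly_roots_bound[OF \<open>q \<noteq> 0\<close>] q(1) by simp
      finally show False by (simp add: card_image inj_on_def)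
    qed
    thus ?case using q(2)[of "y k"] by simp
  qed
  from this[of d] show ?thesis by simp
qed

section \<open>Underdetermined linear systems\<close>

text \<open>Gaussian elimination: one equation is used to remove one unknown.\<close>

lemma underdetermined_system:
  fixes M :: "'b \<Rightarrow> 'a \<Rightarrow> 'c :: field"
  assumes "finite B" "finite A" "card B < card A"
  shows "\<exists>x. (\<exists>a\<in>A. x a \<noteq> 0) \<and> (\<forall>b\<in>B. (\<Sum>a\<in>A. x a * M b a) = 0)"
  using assms
proof (induction B arbitrary: A M rule: finite_induct)
  case empty
  thus ?case by (intro exI[of _ "\<lambda>_. 1"]) (auto simp: card_gt_0_iff)
next
  case (insert b B)
  show ?case
  proof (cases "\<forall>a\<in>A. M b a = 0")
    case True
    thus ?thesis using insert.IH[of A M] insert.prems insert.hyps by auto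
  next
    case False
    then obtain a0 where a0: "a0 \<in> A" "M b a0 \<noteq> 0" by blast
    define M' where "M' = (\<lambda>b' a. M b' a - M b' a0 * M b a / M b a0)"
    have "card B < card (A - {a0})" using insert.prems insert.hyps a0 by simp
    then obtain x where x: "\<exists>a\<in>A - {a0}. x a \<noteq> 0" "\<And>b'. b' \<in> B \<Longrightarrow> (\<Sum>a\<in>A - {a0}. x a * M' b' a) = 0"
      using insert.IH[of "A - {a0}" M'] insert.prems by auto
    define s where "s = (\<Sum>a\<in>A - {a0}. x a * M b a)"
    let ?x = "x(a0 := - s / M b a0)"
    have split: "(\<Sum>a\<in>A. ?x a * M b' a) = - s / M b a0 * M b' a0 + (\<Sum>a\<in>A - {a0}. x a * M b' a)" for b'
      using insert.prems(1) a0(1) by (subst sum.remove[of A a0]) (auto intro!: sum.cong)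
    have "(\<Sum>a\<in>A. ?x a * M b' a) = 0" if "b' \<in> insert b B" for b'
    proof (cases "b' = b")
      case True
      show ?thesis by (subst split) (use a0 True in \<open>simp add: s_def\<close>)
    next
      case False
      hence "0 = (\<Sum>a\<in>A - {a0}. x a * M' b' a)" using x(2) that by auto
      also have "\<dots> = (\<Sum>a\<in>A - {a0}. x a * M b' a) - (\<Sum>a\<in>A - {a0}. M b' a0 / M b a0 * (x a * M b a))"
        unfolding M'_def by (subst sum_subtractf[symmetric]) (auto intro!: sum.cong simp: algebra_simps)
      also have "\<dots> = (\<Sum>a\<in>A - {a0}. x a * M b' a) - M b' a0 / M b a0 * s"
        by (simp only: s_def sum_distrib_left)
      also have "\<dots> = (\<Sum>a\<in>A. ?x a * M b' a)"
        by (subst split) simp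
      finally show ?thesis by simp
    qed
    moreover have "\<exists>a\<in>A. ?x a \<noteq> 0" using x(1) by auto
    ultimately show ?thesis by blast
  qed
qed

section \<open>The dimension of a principal open set\<close>

lemma separating_polyfun:
  assumes "algebraic_set n Z" "x \<in> carrier_vec n" "x \<notin> Z"
  shows "\<exists>f. polyfun n f \<and> (\<forall>z\<in>Z. f (($) z) = 0) \<and> f (($) x) \<noteq> 0"
proof -
  obtain F where F: "\<forall>f\<in>F. polyfun n f" "Z = {x \<in> carrier_vec n. \<forall>f\<in>F. f (($) x) = 0}"
    using assms(1) by (rule algebraic_set_as_polyfun_zeros)
  thus ?thesis using assms by blast
qed

abbreviation exponent_box :: "nat \<Rightarrow> nat \<Rightarrow> (nat \<Rightarrow> nat) set" where
  "exponent_box r K \<equiv> PiE {..<r} (\<lambda>_. {..K})"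

lemma sum_exponent_box_Suc:
  "(\<Sum>m\<in>exponent_box (Suc r) K. F m) = (\<Sum>j\<le>K. \<Sum>m\<in>exponent_box r K. F (m(r := j)))"
proof -
  have "exponent_box (Suc r) K = (\<lambda>(j, m). m(r := j)) ` ({..K} \<times> exponent_box r K)"
    unfolding lessThan_Suc by (rule PiE_insert_eq)
  moreover have "inj_on (\<lambda>(j, m). m(r := j)) ({..K} \<times> exponent_box r K)"
    using inj_combinator[of r "{..<r}" "\<lambda>_. {..K}"] by simp
  ultimately show ?thesis
    by (simp add: sum.reindex sum.cartesian_product case_prod_unfold)
qed

text \<open>One step of the independence proof. In a relation among powers of \<open>g\<close>, where \<open>g\<close> vanishes on
  \<open>Z\<close> but not on the irreducible set \<open>W\<close>, a power of \<open>g\<close> can be cancelled on \<open>W\<close>, and what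
  remains of the lowest term must vanish on \<open>Z\<close>.\<close>

lemma leading_coefficients_vanish:
  assumes W: "affine_variety n W" and Z: "Z \<subseteq> W" and g: "polyfun n g" "\<forall>z\<in>Z. g (($) z) = 0"
    "\<exists>w\<in>W. g (($) w) \<noteq> 0"
    and Q: "\<And>j. polyfun n (Q j)"
    and det: "\<And>j. \<forall>z\<in>Z. Q j (($) z) = 0 \<Longrightarrow> \<forall>w\<in>W. Q j (($) w) = 0"
    and sum: "\<And>w. w \<in> W \<Longrightarrow> (\<Sum>j\<le>K. Q j (($) w) * g (($) w) ^ j) = 0"
  shows "j \<le> K \<Longrightarrow> \<forall>z\<in>Z. Q j (($) z) = 0"
proof (induction j rule: less_induct)
  case (less j)
  define R where "R = (\<lambda>y. \<Sum>i=j..K. Q i y * g y ^ (i - j))"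
  have R: "polyfun n R" unfolding R_def by (intro polyfun_intros Q g)
  have gpow: "polyfun n (\<lambda>y. g y ^ j)" by (intro polyfun_intros g)
  have "g (($) w) ^ j * R (($) w) = 0" if w: "w \<in> W" for w
  proof -
    have "(\<Sum>i\<le>K. Q i (($) w) * g (($) w) ^ i) = (\<Sum>i=j..K. Q i (($) w) * g (($) w) ^ i)"
    proof (rule sum.mono_neutral_right)
      show "\<forall>i\<in>{..K} - {j..K}. Q i (($) w) * g (($) w) ^ i = 0"
        using less.IH less.prems det w by auto
    qed auto
    also have "\<dots> = g (($) w) ^ j * R (($) w)"
      unfolding R_def sum_distrib_left
      by (rule sum.cong) (auto simp: mult_ac simp flip: power_add)
    finally show ?thesis using sum[OF w] by simp
  qed
  hence "\<forall>w\<in>W. R (($) w) = 0"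
    using irreducible_polyfun_mult_zero[OF W gpow R] g(3) by auto
  moreover have "R (($) z) = Q j (($) z)" if "z \<in> Z" for z
  proof -
    have "R (($) z) = (\<Sum>i\<in>{j}. Q i (($) z) * g (($) z) ^ (i - j))"
      unfolding R_def by (rule sum.mono_neutral_right) (use less.prems g(2) that in auto)
    thus ?thesis by simp
  qed
  ultimately show ?case using Z by (metis subsetD)
qed

text \<open>Each \<open>g i\<close> vanishes on one member of the chain and not on the next one; such functions satisfy no
  polynomial relation on the top member, because the coefficients of a relation with respect to
  the last function vanish one step further down.\<close>

lemma chain_algebraically_independent:
  assumes Z: "\<And>i. i \<le> r \<Longrightarrow> affine_variety n (Z i)" "\<And>i. i < r \<Longrightarrow> Z i \<subseteq> Z (Suc i)"
    and g: "\<And>i. i < r \<Longrightarrow> polyfun n (g i)" "\<And>i. i < r \<Longrightarrow> \<forall>z\<in>Z i. g i (($) z) = 0"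
      "\<And>i. i < r \<Longrightarrow> \<exists>z\<in>Z (Suc i). g i (($) z) \<noteq> 0"
    and rel: "\<And>z. z \<in> Z r \<Longrightarrow> (\<Sum>m\<in>exponent_box r K. c m * (\<Prod>i<r. g i (($) z) ^ m i)) = 0"
    and m: "m \<in> exponent_box r K"
  shows "c m = 0"
  using assms
proof (induction r arbitrary: c m)
  case 0
  obtain z where "z \<in> Z 0" using "0.prems"(1)[of 0] unfolding affine_variety_def by auto
  thus ?case using "0.prems"(6)[of z] "0.prems"(7) by simp
next
  case (Suc r)
  define Q where "Q = (\<lambda>j y. \<Sum>m\<in>exponent_box r K. c (m(r := j)) * (\<Prod>i<r. g i y ^ m i))"
  have coeffs: "c (m(r := j)) = 0"
    if "\<forall>z\<in>Z r. Q j (($) z) = 0" "m \<in> exponent_box r K" for j m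
    by (rule Suc.IH[of "\<lambda>m. c (m(r := j))"]) (use Suc.prems that in \<open>auto simp: Q_def\<close>)
  have prods: "(\<Prod>i<Suc r. g i y ^ (m'(r := j)) i) = (\<Prod>i<r. g i y ^ m' i) * g r y ^ j" for y m' j
    by simp
  have "\<forall>z\<in>Z r. Q j (($) z) = 0" if "j \<le> K" for j
  proof (rule leading_coefficients_vanish[of n "Z (Suc r)" "Z r" "g r" Q])
    show "polyfun n (Q j)" for j
      unfolding Q_def by (intro polyfun_intros) (use Suc.prems(3) in auto)
    show "\<forall>w\<in>Z (Suc r). Q j (($) w) = 0" if "\<forall>z\<in>Z r. Q j (($) z) = 0" for j
      using coeffs[OF that] by (simp add: Q_def)
    show "(\<Sum>j\<le>K. Q j (($) w) * g r (($) w) ^ j) = 0" if "w \<in> Z (Suc r)" for w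
      using Suc.prems(6)[OF that]
      unfolding sum_exponent_box_Suc prods by (simp only: Q_def sum_distrib_right mult.assoc)
  qed (use Suc.prems that in auto)
  moreover have "m r \<le> K" "restrict m {..<r} \<in> exponent_box r K"
    using Suc.prems(7) by (auto simp: PiE_iff)
  ultimately have "c ((restrict m {..<r})(r := m r)) = 0" by (intro coeffs) auto
  moreover have "(restrict m {..<r})(r := m r) = m"
    using Suc.prems(7) by (auto simp: fun_eq_iff PiE_iff extensional_def less_Suc_eq)
  ultimately show ?case by simp
qed

text \<open>For a chain of length \<open>r\<close>, the monomials of degree at most \<open>K\<close> in each of the \<open>r\<close> independent
  functions become, after clearing denominators, polynomials of separate degree at most \<open>C K\<close> in
  \<open>d\<close> variables. There are \<open>(K + 1)\<^sup>r\<close> of them and \<open>(C K + 1)\<^sup>d\<close> grid points, so for \<open>r > d\<close> and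
  large \<open>K\<close> some nontrivial combination vanishes.\<close>

lemma variety_dim_principal_open_le:
  assumes h: "polyfun d h"
  shows "variety_dim (Suc d) (principal_open d h) \<le> enat d"
  unfolding variety_dim_def
proof (rule SUP_least)
  fix r assume "r \<in> {r. \<exists>Z. (\<forall>i\<le>r. affine_variety (Suc d) (Z i) \<and> Z i \<subseteq> principal_open d h) \<and>
                     (\<forall>i<r. Z i \<subset> Z (Suc i))}"
  then obtain Z where Z: "\<And>i. i \<le> r \<Longrightarrow> affine_variety (Suc d) (Z i)"
      "\<And>i. i \<le> r \<Longrightarrow> Z i \<subseteq> principal_open d h" "\<And>i. i < r \<Longrightarrow> Z i \<subset> Z (Suc i)"
    by auto
  have "\<exists>g. polyfun (Suc d) g \<and> (\<forall>z\<in>Z i. g (($) z) = 0) \<and> (\<exists>z\<in>Z (Suc i). g (($) z) \<noteq> 0)"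
    if i: "i < r" for i
  proof -
    obtain x where x: "x \<in> Z (Suc i)" "x \<notin> Z i" using Z(3)[OF i] by blast
    have "x \<in> carrier_vec (Suc d)" using x(1) Z(2)[of "Suc i"] i by (auto simp: principal_open_def)
    moreover have "algebraic_set (Suc d) (Z i)" using Z(1)[of i] i by (simp add: affine_variety_def)
    ultimately show ?thesis using separating_polyfun x by blast
  qed
  then obtain g where g: "\<And>i. i < r \<Longrightarrow> polyfun (Suc d) (g i)"
      "\<And>i. i < r \<Longrightarrow> \<forall>z\<in>Z i. g i (($) z) = 0" "\<And>i. i < r \<Longrightarrow> \<exists>z\<in>Z (Suc i). g i (($) z) \<noteq> 0"
    by metis
  have "\<exists>N G. polyfun d G \<and> (\<forall>y. h y \<noteq> 0 \<longrightarrow> g i (($) (open_pt d h y)) * h y ^ N = G y)"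
    if "i < r" for i
    using clear_denominators[OF g(1)[OF that] h] by blast
  then obtain N0 G0 where G0: "\<And>i. i < r \<Longrightarrow> polyfun d (G0 i)"
      "\<And>i y. i < r \<Longrightarrow> h y \<noteq> 0 \<Longrightarrow> g i (($) (open_pt d h y)) * h y ^ N0 i = G0 i y"
    by metis
  define N where "N = (\<Sum>i<r. N0 i)"
  have N0_le: "N0 i \<le> N" if "i < r" for i
    unfolding N_def using that by (intro member_le_sum) auto
  define G where "G = (\<lambda>i y. G0 i y * h y ^ (N - N0 i))"
  have G: "polyfun d (G i)" if "i < r" for i
    unfolding G_def by (intro polyfun_intros G0 h that)
  have G_eq: "G i y = g i (($) (open_pt d h y)) * h y ^ N" if "i < r" "h y \<noteq> 0" for i y
    unfolding G_def G0(2)[OF that, symmetric] using N0_le[OF that(1)]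
    by (simp flip: power_add add: mult.assoc)
  have "\<exists>D. separate_degree_le d (G i) D" if "i < r" for i
    using polyfun_separate_degree_le[OF G[OF that]] .
  then obtain DG where DG: "\<And>i. i < r \<Longrightarrow> separate_degree_le d (G i) (DG i)" by metis
  obtain Dh where Dh: "separate_degree_le d h Dh" using polyfun_separate_degree_le[OF h] by blast
  define E where "E = (\<Sum>i<r. DG i) + N * Dh"
  define C where "C = r * (E + E)"
  \<comment> \<open>Chosen so that \<open>(C K + 1)\<^sup>d \<le> (C + 1)\<^sup>d (K + 1)\<^sup>d = K (K + 1)\<^sup>d < (K + 1)\<^sup>d\<^sup>+\<^sup>1\<close>.\<close>
  define K where "K = Suc C ^ d"
  \<comment> \<open>Padding with powers of \<open>h\<close> gives all monomials the same denominator, the power \<open>N K r\<close> of \<open>h\<close>.\<close>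
  define F where "F = (\<lambda>m y. \<Prod>i<r. G i y ^ m i * h y ^ (N * (K - m i)))"
  have F: "polyfun d (F m)" for m
    unfolding F_def by (intro polyfun_intros h) (use G in auto)
  have degF: "separate_degree_le d (F m) (C * K)" if m: "m \<in> exponent_box r K" for m
  proof -
    have "separate_degree_le d (\<lambda>y. G i y ^ m i * h y ^ (N * (K - m i))) (K * E + K * E)"
      if i: "i < r" for i
    proof (rule separate_degree_le_mult)
      have mi: "m i \<le> K" using m i by (auto simp: PiE_iff)
      have "DG i \<le> E" unfolding E_def using i by (intro trans_le_add1 member_le_sum) auto
      thus "separate_degree_le d (\<lambda>y. G i y ^ m i) (K * E)"
        by (intro separate_degree_le_mono[OF separate_degree_le_power[OF DG[OF i]]] mult_le_mono mi)
      have "N * (K - m i) * Dh \<le> K * E"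
      proof -
        have "N * (K - m i) * Dh = (K - m i) * (N * Dh)" by simp
        also have "\<dots> \<le> K * E" unfolding E_def by (intro mult_le_mono) auto
        finally show ?thesis .
      qed
      thus "separate_degree_le d (\<lambda>y. h y ^ (N * (K - m i))) (K * E)"
        by (intro separate_degree_le_mono[OF separate_degree_le_power[OF Dh]])
    qed
    hence "separate_degree_le d (F m) (card {..<r} * (K * E + K * E))"
      unfolding F_def by (intro separate_degree_le_prod) auto
    thus ?thesis by (simp add: C_def algebra_simps)
  qed
  show "enat r \<le> enat d"
  proof (rule ccontr)
    assume "\<not> enat r \<le> enat d"
    hence r: "Suc d \<le> r" by simp
    let ?B = "PiE {..<d} (\<lambda>_. (of_nat :: nat \<Rightarrow> complex) ` {..C * K})"
    have "card ?B = Suc (C * K) ^ d" by (simp add: card_PiE card_image inj_on_def)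
    also have "\<dots> \<le> (Suc C * Suc K) ^ d" by (intro power_mono) auto
    also have "\<dots> = K * Suc K ^ d" by (simp only: power_mult_distrib K_def)
    also have "\<dots> < Suc K * Suc K ^ d" by simp
    also have "\<dots> = Suc K ^ Suc d" by simp
    also have "\<dots> \<le> Suc K ^ r" using r by (intro power_increasing) auto
    also have "\<dots> = card (exponent_box r K)" by (simp add: card_PiE)
    finally have "card ?B < card (exponent_box r K)" .
    then obtain c where c: "\<exists>m\<in>exponent_box r K. c m \<noteq> 0"
        "\<forall>y\<in>?B. (\<Sum>m\<in>exponent_box r K. c m * F m y) = 0"
      using underdetermined_system[of ?B "exponent_box r K" "\<lambda>y m. F m y"]
      by (auto simp: finite_PiE)
    define S where "S = (\<lambda>y. \<Sum>m\<in>exponent_box r K. c m * F m y)"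
    have S_zero: "S y = 0" for y
    proof (rule zero_on_grid_imp_zero[of d S "C * K"])
      show "polyfun d S" unfolding S_def by (intro polyfun_intros F)
      have "separate_degree_le d (\<lambda>y. c m * F m y) (0 + C * K)" if "m \<in> exponent_box r K" for m
        by (intro separate_degree_le_mult separate_degree_le_const degF that)
      thus "separate_degree_le d S (C * K)"
        unfolding S_def by (intro separate_degree_le_sum) simp
      show "\<And>y. y \<in> ?B \<Longrightarrow> S y = 0" using c(2) by (simp add: S_def)
    qed
    have "c m = 0" if "m \<in> exponent_box r K" for m
    proof (rule chain_algebraically_independent[of r "Suc d" Z g c K])
      fix z assume "z \<in> Z r"
      hence "z \<in> principal_open d h" using Z(2) by blast
      then obtain y where y: "h y \<noteq> 0" "z = open_pt d h y" by (rule principal_openE)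
      have "F m y = h y ^ (N * K * r) * (\<Prod>i<r. g i (($) z) ^ m i)" if m: "m \<in> exponent_box r K" for m
      proof -
        have "G i y ^ m i * h y ^ (N * (K - m i)) = h y ^ (N * K) * g i (($) z) ^ m i" if i: "i < r" for i
        proof -
          have "m i \<le> K" using m i by (auto simp: PiE_iff)
          hence "N * m i + N * (K - m i) = N * K" by (simp flip: add_mult_distrib2)
          thus ?thesis unfolding G_eq[OF i y(1)] y(2)
            by (simp add: power_mult_distrib mult_ac flip: power_add power_mult)
        qed
        thus ?thesis unfolding F_def by (simp add: prod.distrib power_mult)
      qed
      hence "S y = h y ^ (N * K * r) * (\<Sum>m\<in>exponent_box r K. c m * (\<Prod>i<r. g i (($) z) ^ m i))"
        unfolding S_def sum_distrib_left by (intro sum.cong) auto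
      thus "(\<Sum>m\<in>exponent_box r K. c m * (\<Prod>i<r. g i (($) z) ^ m i)) = 0"
        using S_zero[of y] y(1) by simp
    qed (use Z(1) psubset_imp_subset[OF Z(3)] g that in auto)
    thus False using c(1) by blast
  qed
qed

section \<open>Tangent spaces and smoothness\<close>

lemma dim_graph_of_linear_form:
  fixes l :: "nat \<Rightarrow> complex" and d :: nat
  defines "T \<equiv> {v \<in> carrier_vec (Suc d). v $ d = (\<Sum>i<d. l i * v $ i)}"
  shows "vectorspace.dim class_ring ((module_vec TYPE(complex) (Suc d))\<lparr>carrier := T\<rparr>) = d"
proof -
  let ?V = "module_vec TYPE(complex) d"
  let ?W = "module_vec TYPE(complex) (Suc d)"
  interpret V: vec_space "TYPE(complex)" d .
  interpret W: vec_space "TYPE(complex)" "Suc d" .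
  have "submodule class_ring T ?W"
  proof (rule submodule.intro)
    show "Module.module class_ring ?W" by (rule W.module_axioms)
  qed (auto simp: T_def module_vec_simps sum.distrib sum_distrib_left algebra_simps)
  hence "subspace class_ring T ?W"
    by (intro subspace.intro vec_vs)
  hence WT: "vectorspace class_ring (?W\<lparr>carrier := T\<rparr>)"
    by (rule W.subspace_is_vs)
  define \<phi> where "\<phi> = (\<lambda>v :: complex vec. vec (Suc d) (\<lambda>i. if i < d then v $ i else (\<Sum>i<d. l i * v $ i)))"
  have \<phi>_in: "\<phi> v \<in> T" if "v \<in> carrier_vec d" for v
    by (auto simp: \<phi>_def T_def)
  have "\<phi> \<in> module_hom class_ring ?V (?W\<lparr>carrier := T\<rparr>)"
    unfolding module_hom_def
    by (auto simp: module_vec_simps \<phi>_in)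
       (auto simp: \<phi>_def vec_eq_iff sum.distrib sum_distrib_left algebra_simps)
  then interpret \<phi>: linear_map class_ring ?V "?W\<lparr>carrier := T\<rparr>" \<phi>
    by (intro linear_map.intro mod_hom.intro mod_hom_axioms.intro WT V.vectorspace_axioms
        V.module_axioms vectorspace.axioms(1))
  have "inj_on \<phi> (carrier ?V)"
  proof (rule inj_onI)
    fix v w assume *: "v \<in> carrier ?V" "w \<in> carrier ?V" "\<phi> v = \<phi> w"
    have "v $ i = w $ i" if "i < d" for i
      using arg_cong[OF *(3), of "\<lambda>x. x $ i"] that by (simp add: \<phi>_def)
    thus "v = w" using * by (auto simp: module_vec_simps)
  qed
  moreover have "\<phi> ` carrier ?V = carrier (?W\<lparr>carrier := T\<rparr>)"
  proof
    show "carrier (?W\<lparr>carrier := T\<rparr>) \<subseteq> \<phi> ` carrier ?V"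
    proof
      fix w assume "w \<in> carrier (?W\<lparr>carrier := T\<rparr>)"
      hence "w = \<phi> (vec d (($) w))"
        by (intro eq_vecI) (auto simp: \<phi>_def T_def less_Suc_eq)
      thus "w \<in> \<phi> ` carrier ?V" by (auto simp: module_vec_simps)
    qed
  qed (auto simp: module_vec_simps \<phi>_in)
  ultimately have "V.dim = vectorspace.dim class_ring (?W\<lparr>carrier := T\<rparr>)"
    by (intro \<phi>.dim_eq) auto
  thus ?thesis by (simp add: V.dim_is_n)
qed

lemma DERIV_monom_eval:
  assumes m: "Poly_Mapping.keys m \<subseteq> {..<n}"
    and \<gamma>: "\<And>i. i < n \<Longrightarrow> ((\<lambda>t. \<gamma> t i) has_field_derivative \<gamma>' i) (at z)"
  shows "((\<lambda>t. monom_eval m (vec n (\<gamma> t))) has_field_derivative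
     (\<Sum>i<n. of_nat (Poly_Mapping.lookup m i) *
        monom_eval (m - Poly_Mapping.single i 1) (vec n (\<gamma> z)) * \<gamma>' i)) (at z)"
proof -
  have eval: "monom_eval k (vec n y) = (\<Prod>i<n. y i ^ Poly_Mapping.lookup k i)"
    if "Poly_Mapping.keys k \<subseteq> {..<n}" for k y
    using monom_eval_superset[OF _ that, of "vec n y"] by (auto intro: prod.cong)
  have "((\<lambda>t. \<Prod>i<n. \<gamma> t i ^ Poly_Mapping.lookup m i) has_field_derivative
      (\<Sum>i<n. of_nat (Poly_Mapping.lookup m i) * (\<gamma>' i * \<gamma> z i ^ (Poly_Mapping.lookup m i - 1)) *
         (\<Prod>j\<in>{..<n} - {i}. \<gamma> z j ^ Poly_Mapping.lookup m j))) (at z)"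
    by (intro has_field_derivative_prod) (use DERIV_power[OF \<gamma>] in auto)
  moreover have "monom_eval (m - Poly_Mapping.single i 1) (vec n (\<gamma> z)) =
      \<gamma> z i ^ (Poly_Mapping.lookup m i - 1) * (\<Prod>j\<in>{..<n} - {i}. \<gamma> z j ^ Poly_Mapping.lookup m j)"
    if i: "i < n" for i
  proof -
    have "Poly_Mapping.keys (m - Poly_Mapping.single i 1) \<subseteq> {..<n}"
    proof
      fix j assume "j \<in> Poly_Mapping.keys (m - Poly_Mapping.single i 1)"
      hence "Poly_Mapping.lookup m j \<noteq> 0" by (auto simp: in_keys_iff lookup_minus)
      hence "j \<in> Poly_Mapping.keys m" by (simp add: in_keys_iff)
      thus "j \<in> {..<n}" using m by blast
    qed
    hence "monom_eval (m - Poly_Mapping.single i 1) (vec n (\<gamma> z)) =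
       (\<Prod>j<n. \<gamma> z j ^ (Poly_Mapping.lookup (m - Poly_Mapping.single i 1) j))"
      by (rule eval)
    also have "\<dots> = \<gamma> z i ^ (Poly_Mapping.lookup m i - 1) *
        (\<Prod>j\<in>{..<n} - {i}. \<gamma> z j ^ Poly_Mapping.lookup m j)"
      using i by (subst prod.remove[of _ i])
        (auto simp: lookup_minus lookup_single when_def intro!: prod.cong)
    finally show ?thesis .
  qed
  ultimately show ?thesis
    by (simp add: eval[OF m] mult_ac)
qed

lemma DERIV_mpoly_eval:
  assumes p: "p \<in> polys n"
    and \<gamma>: "\<And>i. i < n \<Longrightarrow> ((\<lambda>t. \<gamma> t i) has_field_derivative \<gamma>' i) (at z)"
  shows "((\<lambda>t. mpoly_eval p (vec n (\<gamma> t))) has_field_derivative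
     (\<Sum>i<n. mpoly_eval (mpoly_pderiv i p) (vec n (\<gamma> z)) * \<gamma>' i)) (at z)"
proof -
  let ?D = "\<lambda>i m. of_nat (Poly_Mapping.lookup m i) *
        monom_eval (m - Poly_Mapping.single i 1) (vec n (\<gamma> z)) * \<gamma>' i"
  have "((\<lambda>t. \<Sum>m\<in>Poly_Mapping.keys p. Poly_Mapping.lookup p m * monom_eval m (vec n (\<gamma> t)))
      has_field_derivative (\<Sum>m\<in>Poly_Mapping.keys p. Poly_Mapping.lookup p m * (\<Sum>i<n. ?D i m))) (at z)"
    by (intro DERIV_sum DERIV_cmult DERIV_monom_eval \<gamma>) (use p in \<open>auto simp: polys_def\<close>)
  also have "(\<Sum>m\<in>Poly_Mapping.keys p. Poly_Mapping.lookup p m * (\<Sum>i<n. ?D i m))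
      = (\<Sum>i<n. mpoly_eval (mpoly_pderiv i p) (vec n (\<gamma> z)) * \<gamma>' i)"
    unfolding mpoly_pderiv_def mpoly_eval_sum sum_distrib_left sum_distrib_right
    by (subst sum.swap) (simp add: mult_ac)
  finally show ?thesis unfolding mpoly_eval_altdef .
qed

lemma polyfun_chain_rule:
  assumes "polyfun n f"
  obtains l where "\<And>\<gamma> \<gamma>'. \<gamma> 0 = y \<Longrightarrow>
      (\<And>i. i < n \<Longrightarrow> ((\<lambda>t. \<gamma> t i) has_field_derivative \<gamma>' i) (at 0)) \<Longrightarrow>
      ((\<lambda>t. f (\<gamma> t)) has_field_derivative (\<Sum>i<n. l i * \<gamma>' i)) (at 0)"
proof -
  obtain p where p: "p \<in> polys n" "\<forall>x. mpoly_eval p x = f (($) x)"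
    using mpoly_of_polyfun[OF assms] by blast
  have eq: "mpoly_eval p (vec n (\<gamma> t)) = f (\<gamma> t)" for \<gamma> :: "complex \<Rightarrow> nat \<Rightarrow> complex" and t
    using polyfun_cong_arg[OF assms, of "($) (vec n (\<gamma> t))" "\<gamma> t"] p(2) by simp
  show ?thesis
  proof (rule that[of "\<lambda>i. mpoly_eval (mpoly_pderiv i p) (vec n y)"])
    fix \<gamma> :: "complex \<Rightarrow> nat \<Rightarrow> complex" and \<gamma>'
    assume y: "\<gamma> 0 = y" and d: "\<And>i. i < n \<Longrightarrow> ((\<lambda>t. \<gamma> t i) has_field_derivative \<gamma>' i) (at 0)"
    show "((\<lambda>t. f (\<gamma> t)) has_field_derivative
        (\<Sum>i<n. mpoly_eval (mpoly_pderiv i p) (vec n y) * \<gamma>' i)) (at 0)"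
      using DERIV_mpoly_eval[OF p(1), of \<gamma> \<gamma>' 0] d unfolding eq y by blast
  qed
qed

text \<open>The equation of the principal open set confines the tangent space to the graph of a linear form,
  and every vector of that graph is the velocity of a curve \<open>t \<mapsto> (y + t v, 1 / h (y + t v))\<close> in the
  set, along which every function of the vanishing ideal has derivative zero.\<close>

lemma tangent_space_principal_open:
  assumes h: "polyfun d h" and y: "h y \<noteq> 0"
  shows "\<exists>l. tangent_space (Suc d) (principal_open d h) (open_pt d h y) =
     {v \<in> carrier_vec (Suc d). v $ d = (\<Sum>i<d. l i * v $ i)}"
proof -
  let ?X = "principal_open d h" and ?x = "open_pt d h y"
  obtain l where l: "\<And>\<gamma> \<gamma>'. \<gamma> 0 = y \<Longrightarrow>
      (\<And>i. i < d \<Longrightarrow> ((\<lambda>t. \<gamma> t i) has_field_derivative \<gamma>' i) (at 0)) \<Longrightarrow>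
      ((\<lambda>t. h (\<gamma> t)) has_field_derivative (\<Sum>i<d. l i * \<gamma>' i)) (at 0)"
    using polyfun_chain_rule[OF h, of y] by blast
  define l' where "l' = (\<lambda>i. - l i / (h y)^2)"
  have dh: "((\<lambda>t. h (\<lambda>i. y i + t * v $ i)) has_field_derivative (\<Sum>i<d. l i * v $ i)) (at 0)" for v
    by (rule l) (auto intro!: derivative_eq_intros)
  have sum_l': "(\<Sum>i<d. l' i * v $ i) = - (\<Sum>i<d. l i * v $ i) / (h y)^2" for v
    by (simp add: l'_def sum_divide_distrib sum_negf)
  have "v $ d = (\<Sum>i<d. l' i * v $ i)" if v: "v \<in> tangent_space (Suc d) ?X ?x" for v
  proof -
    have "polyfun (Suc d) (\<lambda>y. h y * y d - 1)"
      by (intro polyfun_intros polyfun_mono[OF h]) auto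
    then obtain p where p: "p \<in> polys (Suc d)" "\<forall>x. mpoly_eval p x = h (($) x) * x $ d - 1"
      using mpoly_of_polyfun by blast
    let ?\<gamma> = "\<lambda>t i. if i < d then y i + t * v $ i else 1 / h y + t * v $ d"
    have "p \<in> vanishing_ideal (Suc d) ?X"
      using p by (auto simp: vanishing_ideal_def principal_open_def)
    hence "(\<Sum>i<Suc d. mpoly_eval (mpoly_pderiv i p) ?x * v $ i) = 0"
      using v unfolding tangent_space_def by blast
    moreover have "((\<lambda>t. mpoly_eval p (vec (Suc d) (?\<gamma> t))) has_field_derivative
        (\<Sum>i<Suc d. mpoly_eval (mpoly_pderiv i p) (vec (Suc d) (?\<gamma> 0)) * v $ i)) (at 0)"
      by (rule DERIV_mpoly_eval[OF p(1)]) (auto intro!: derivative_eq_intros simp: less_Suc_eq)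
    moreover have "vec (Suc d) (?\<gamma> 0) = ?x"
      unfolding open_pt_def by (rule eq_vecI) auto
    moreover have "mpoly_eval p (vec (Suc d) (?\<gamma> t)) =
        h (\<lambda>i. y i + t * v $ i) * (1 / h y + t * v $ d) - 1" for t
      using polyfun_cong_arg[OF h, of "($) (vec (Suc d) (?\<gamma> t))" "\<lambda>i. y i + t * v $ i"] p(2) by simp
    ultimately have "((\<lambda>t. h (\<lambda>i. y i + t * v $ i) * (1 / h y + t * v $ d) - 1)
        has_field_derivative 0) (at 0)"
      by simp
    moreover have "((\<lambda>t. h (\<lambda>i. y i + t * v $ i) * (1 / h y + t * v $ d) - 1)
        has_field_derivative (\<Sum>i<d. l i * v $ i) / h y + h y * v $ d) (at 0)"
      by (auto intro!: derivative_eq_intros dh)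
    ultimately have "(\<Sum>i<d. l i * v $ i) / h y + h y * v $ d = 0"
      using DERIV_unique by blast
    hence "(\<Sum>i<d. l i * v $ i) + (h y)^2 * v $ d = 0"
      using y by (simp add: field_simps power2_eq_square)
    hence "v $ d * (h y)^2 = - (\<Sum>i<d. l i * v $ i)"
      by (simp add: add_eq_0_iff mult.commute)
    thus ?thesis unfolding sum_l' using y by (subst eq_divide_eq) simp
  qed
  moreover have "v \<in> tangent_space (Suc d) ?X ?x"
    if v: "v \<in> carrier_vec (Suc d)" "v $ d = (\<Sum>i<d. l' i * v $ i)" for v
    unfolding tangent_space_def
  proof (intro CollectI conjI v(1) ballI)
    fix p assume p: "p \<in> vanishing_ideal (Suc d) ?X"
    let ?y = "\<lambda>t i. y i + t * v $ i"
    let ?\<gamma> = "\<lambda>t i. if i < d then ?y t i else 1 / h (?y t)"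
    have "isCont (\<lambda>t. h (?y t)) 0"
      using dh[of v] by (rule DERIV_isCont)
    hence "((\<lambda>t. h (?y t)) \<longlongrightarrow> h (?y 0)) (nhds 0)"
      using tendsto_at_iff_tendsto_nhds[of "\<lambda>t. h (?y t)" 0] unfolding isCont_def by blast
    hence "\<forall>\<^sub>F t in nhds 0. h (?y t) \<noteq> 0"
      by (rule tendsto_imp_eventually_ne) (use y in simp)
    hence ev: "\<forall>\<^sub>F t in nhds 0. mpoly_eval p (vec (Suc d) (?\<gamma> t)) = 0"
    proof eventually_elim
      case (elim t)
      hence "open_pt d h (?y t) \<in> ?X" by (rule open_pt_in_principal_open[OF h])
      thus ?case using p unfolding vanishing_ideal_def open_pt_def by auto
    qed
    have "((\<lambda>t. mpoly_eval p (vec (Suc d) (?\<gamma> t))) has_field_derivative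
        (\<Sum>i<Suc d. mpoly_eval (mpoly_pderiv i p) (vec (Suc d) (?\<gamma> 0)) * v $ i)) (at 0)"
    proof (rule DERIV_mpoly_eval)
      show "p \<in> polys (Suc d)" using p by (simp add: vanishing_ideal_def)
      show "((\<lambda>t. ?\<gamma> t i) has_field_derivative v $ i) (at 0)" if "i < Suc d" for i
      proof (cases "i < d")
        case False
        hence "i = d" using that by simp
        moreover have "((\<lambda>t. 1 / h (?y t)) has_field_derivative v $ d) (at 0)"
          using y by (auto intro!: derivative_eq_intros dh[of v] simp: v(2) sum_l' power2_eq_square)
        ultimately show ?thesis by simp
      qed (auto intro!: derivative_eq_intros)
    qed
    moreover have "vec (Suc d) (?\<gamma> 0) = ?x"
      unfolding open_pt_def by (rule eq_vecI) auto
    ultimately have "((\<lambda>t. 0) has_field_derivative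
        (\<Sum>i<Suc d. mpoly_eval (mpoly_pderiv i p) ?x * v $ i)) (at 0)"
      using DERIV_cong_ev[OF refl ev refl] by simp
    thus "(\<Sum>i<Suc d. mpoly_eval (mpoly_pderiv i p) ?x * v $ i) = 0"
      using DERIV_unique DERIV_const by blast
  qed
  moreover have "tangent_space (Suc d) ?X ?x \<subseteq> carrier_vec (Suc d)"
    by (auto simp: tangent_space_def)
  ultimately show ?thesis by (intro exI[of _ l']) blast
qed

theorem smooth_principal_open:
  assumes h: "polyfun d h" and c: "h c \<noteq> 0"
  shows "smooth_affine_variety (Suc d) (principal_open d h)"
    and "variety_dim (Suc d) (principal_open d h) = enat d"
proof -
  show dim: "variety_dim (Suc d) (principal_open d h) = enat d"
    by (intro antisym variety_dim_principal_open_le variety_dim_principal_open_ge[OF h c] h)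
  have "tangent_dim (Suc d) (principal_open d h) x = d" if "x \<in> principal_open d h" for x
  proof (rule principal_openE[OF that])
    assume "h (($) x) \<noteq> 0" and x: "x = open_pt d h (($) x)"
    then obtain l where "tangent_space (Suc d) (principal_open d h) x =
        {v \<in> carrier_vec (Suc d). v $ d = (\<Sum>i<d. l i * v $ i)}"
      using tangent_space_principal_open[OF h, of "($) x"] by auto
    thus ?thesis unfolding tangent_dim_def by (simp only: dim_graph_of_linear_form)
  qed
  thus "smooth_affine_variety (Suc d) (principal_open d h)"
    unfolding smooth_affine_variety_def dim by (simp add: affine_variety_principal_open[OF h c])
qed

section \<open>The monomial isomorphism of squares\<close>

text \<open>Integer exponents turn the verification of the monomial substitutions into addition of exponent
  vectors.\<close>

definition laurent :: "complex \<Rightarrow> complex \<Rightarrow> int \<Rightarrow> int \<Rightarrow> complex" where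
  "laurent u u' a b = u powi a * u' powi b"

lemma laurent_mult:
  "u \<noteq> 0 \<Longrightarrow> u' \<noteq> 0 \<Longrightarrow> laurent u u' a b * laurent u u' a' b' = laurent u u' (a + a') (b + b')"
  by (simp add: laurent_def power_int_add mult_ac)

lemma laurent_mult_left:
  "u \<noteq> 0 \<Longrightarrow> u' \<noteq> 0 \<Longrightarrow>
     laurent u u' a b * (laurent u u' a' b' * c) = laurent u u' (a + a') (b + b') * c"
  by (simp add: laurent_mult flip: mult.assoc)

lemma laurent_power: "laurent u u' a b ^ k = laurent u u' (a * int k) (b * int k)"
  by (simp add: laurent_def power_mult_distrib power_int_mult)

lemma laurent_0: "laurent u u' 0 0 = 1"
  by (simp add: laurent_def)

text \<open>The coordinates \<open>(x, u, s, x', u', s')\<close> of a pair of points that matter; the coordinates \<open>z\<close> of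
  both points are carried along unchanged.\<close>

type_synonym twisted_pair = "complex \<times> complex \<times> complex \<times> complex \<times> complex \<times> complex"

text \<open>In these definitions \<open>p\<close> and \<open>p'\<close> are the inverses of \<open>u\<close> and \<open>u'\<close>, and \<open>s * u\<close> and \<open>s' * u'\<close>
  are the inverses of the second factors of the defining polynomials. The exponent matrix of \<open>(u, u')\<close> is
  \<open>(3, 5; 5, 8)\<close>; the factor of \<open>x\<close> is the fifth root of \<open>U\<^sup>2 / u = u\<^sup>5 u'\<^sup>1\<^sup>0\<close>, and similarly for
  \<open>x'\<close>, so that \<open>x\<^sup>5 / u = X\<^sup>5 / U\<^sup>2\<close>.\<close>

definition square_map :: "twisted_pair \<Rightarrow> twisted_pair" where
  "square_map = (\<lambda>(x, u, s, x', u', s').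
     let p = s * (u + x ^ 5); p' = s' * (u' + x' ^ 5) in
     (x * (u * u' ^ 2), u ^ 3 * u' ^ 5, p ^ 8 * p' ^ 15 * (s * u),
      x' * (u ^ 2 * u' ^ 3), u ^ 5 * u' ^ 8, p ^ 15 * p' ^ 23 * (s' * u')))"

text \<open>The inverse substitution, with exponent matrix \<open>(-8, 5; 5, -3)\<close>.\<close>

definition square_map_inv :: "twisted_pair \<Rightarrow> twisted_pair" where
  "square_map_inv = (\<lambda>(x, u, s, x', u', s').
     let p = s * (u ^ 2 + x ^ 5); p' = s' * (u' ^ 2 + x' ^ 5) in
     (x * (p ^ 2 * u'), p ^ 8 * u' ^ 5, u ^ 18 * p' ^ 10 * (s * u),
      x' * (u * p'), u ^ 5 * p' ^ 3, p ^ 10 * u' ^ 8 * (s' * u')))"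

definition on_twisted_square :: "nat \<Rightarrow> twisted_pair \<Rightarrow> bool" where
  "on_twisted_square a = (\<lambda>(x, u, s, x', u', s').
     u * (u ^ a + x ^ 5) * s = 1 \<and> u' * (u' ^ a + x' ^ 5) * s' = 1)"

lemma on_twisted_squareE:
  assumes "on_twisted_square a t"
  obtains x u v x' u' v' where "u \<noteq> 0" "v \<noteq> 0" "u' \<noteq> 0" "v' \<noteq> 0"
    "t = (x, u, 1 / (u * v), x', u', 1 / (u' * v'))" "v = u ^ a + x ^ 5" "v' = u' ^ a + x' ^ 5"
proof -
  obtain x u s x' u' s' where t: "t = (x, u, s, x', u', s')" by (cases t) auto
  have eqs: "u * (u ^ a + x ^ 5) * s = 1" "u' * (u' ^ a + x' ^ 5) * s' = 1"
    using assms by (auto simp: on_twisted_square_def t)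
  have nz: "u \<noteq> 0" "u ^ a + x ^ 5 \<noteq> 0" "u' \<noteq> 0" "u' ^ a + x' ^ 5 \<noteq> 0" using eqs by auto
  have "s = 1 / (u * (u ^ a + x ^ 5))" "s' = 1 / (u' * (u' ^ a + x' ^ 5))"
    using nz eqs by (simp_all only: eq_divide_eq mult.commute[of s] mult.commute[of s'] mult_eq_0_iff)
      simp_all
  thus ?thesis using that[OF nz(1,2,3,4), of x x'] t by simp
qed

lemma square_map:
  assumes "on_twisted_square 1 t"
  shows "on_twisted_square 2 (square_map t)" "square_map_inv (square_map t) = t"
proof -
  obtain x u v x' u' v' where nz: "u \<noteq> 0" "v \<noteq> 0" "u' \<noteq> 0" "v' \<noteq> 0"
    and t: "t = (x, u, 1 / (u * v), x', u', 1 / (u' * v'))" and v: "v = u + x ^ 5" "v' = u' + x' ^ 5"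
    using on_twisted_squareE[OF assms] by (metis power_one_right)
  define m where "m = laurent u u'"
  note arith = laurent_mult[OF nz(1,3), folded m_def] laurent_mult_left[OF nz(1,3), folded m_def]
    laurent_power[of u u', folded m_def] laurent_0[of u u', folded m_def]
  have u: "u = m 1 0" "u' = m 0 1" by (simp_all add: m_def laurent_def)
  have p: "1 / (u * v) * (u + x ^ 5) = m (-1) 0" "1 / (u' * v') * (u' + x' ^ 5) = m 0 (-1)"
    using nz by (simp_all add: m_def laurent_def power_int_minus flip: v) (simp_all add: field_simps)
  have inv: "1 / (u * v) = m (-1) 0 / v" "1 / (u' * v') = m 0 (-1) / v'"
    using nz by (simp_all add: m_def laurent_def power_int_minus field_simps)
  have q: "1 / (u * v) * u = 1 / v" "1 / (u' * v') * u' = 1 / v'" using nz by auto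
  define X U S X' U' S' where defs: "X = x * m 1 2" "U = m 3 5" "S = m (-8) (-15) / v"
    "X' = x' * m 2 3" "U' = m 5 8" "S' = m (-15) (-23) / v'"
  have sq: "square_map t = (X, U, S, X', U', S')"
    unfolding square_map_def t Let_def split p q defs by (simp add: u arith)
  have V: "U ^ 2 + X ^ 5 = m 5 10 * v" "U' ^ 2 + X' ^ 5 = m 10 15 * v'"
    unfolding defs v by (simp_all add: power_mult_distrib arith u ring_distribs mult_ac)
  have S: "S * (U ^ 2 + X ^ 5) = m (-3) (-5)" "S' * (U' ^ 2 + X' ^ 5) = m (-5) (-8)"
    "S * U = m (-5) (-10) / v" "S' * U' = m (-10) (-15) / v'"
    unfolding V using nz by (simp_all add: defs arith mult_ac)
  show "on_twisted_square 2 (square_map t)"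
    unfolding on_twisted_square_def sq split power_one_right V using nz by (simp add: defs arith)
  show "square_map_inv (square_map t) = t"
    unfolding sq square_map_inv_def split Let_def S
    unfolding t inv defs by (simp add: arith u)
qed
lemma square_map_inv:
  assumes "on_twisted_square 2 t"
  shows "on_twisted_square 1 (square_map_inv t)" "square_map (square_map_inv t) = t"
proof -
  obtain x u v x' u' v' where nz: "u \<noteq> 0" "v \<noteq> 0" "u' \<noteq> 0" "v' \<noteq> 0"
    and t: "t = (x, u, 1 / (u * v), x', u', 1 / (u' * v'))" and v: "v = u ^ 2 + x ^ 5" "v' = u' ^ 2 + x' ^ 5"
    using on_twisted_squareE[OF assms] by metis
  define m where "m = laurent u u'"
  note arith = laurent_mult[OF nz(1,3), folded m_def] laurent_mult_left[OF nz(1,3), folded m_def]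
    laurent_power[of u u', folded m_def] laurent_0[of u u', folded m_def]
  have u: "u = m 1 0" "u' = m 0 1" by (simp_all add: m_def laurent_def)
  have p: "1 / (u * v) * (u ^ 2 + x ^ 5) = m (-1) 0" "1 / (u' * v') * (u' ^ 2 + x' ^ 5) = m 0 (-1)"
    using nz by (simp_all add: m_def laurent_def power_int_minus flip: v) (simp_all add: field_simps)
  have inv: "1 / (u * v) = m (-1) 0 / v" "1 / (u' * v') = m 0 (-1) / v'"
    using nz by (simp_all add: m_def laurent_def power_int_minus field_simps)
  have q: "1 / (u * v) * u = 1 / v" "1 / (u' * v') * u' = 1 / v'" using nz by auto
  define X U S X' U' S' where defs: "X = x * m (-2) 1" "U = m (-8) 5" "S = m 18 (-10) / v"
    "X' = x' * m 1 (-1)" "U' = m 5 (-3)" "S' = m (-10) 8 / v'"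
  have sq: "square_map_inv t = (X, U, S, X', U', S')"
    unfolding square_map_inv_def t Let_def split p q defs by (simp add: u arith)
  have V: "U + X ^ 5 = m (-10) 5 * v" "U' + X' ^ 5 = m 5 (-5) * v'"
    unfolding defs v by (simp_all add: power_mult_distrib arith u ring_distribs mult_ac)
  have S: "S * (U + X ^ 5) = m 8 (-5)" "S' * (U' + X' ^ 5) = m (-5) 3"
    "S * U = m 10 (-5) / v" "S' * U' = m (-5) 5 / v'"
    unfolding V using nz by (simp_all add: defs arith mult_ac)
  show "on_twisted_square 1 (square_map_inv t)"
    unfolding on_twisted_square_def sq split power_one_right V using nz by (simp add: defs arith)
  show "square_map (square_map_inv t) = t"
    unfolding sq square_map_def split Let_def S
    unfolding t inv defs by (simp add: arith u)
qed

section \<open>The two varieties and their squares\<close>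

lemma morphism_vec_polyfun:
  assumes "\<And>j. j < m \<Longrightarrow> polyfun n (\<lambda>w. F w j)"
    and "\<And>x. x \<in> X \<Longrightarrow> vec m (F (($) x)) \<in> Y"
  shows "morphism n X m Y (\<lambda>x. vec m (F (($) x)))"
proof -
  have "\<exists>p. p \<in> polys n \<and> (\<forall>x. mpoly_eval p x = F (($) x) j)" if "j < m" for j
    using mpoly_of_polyfun[OF assms(1)[OF that]] by blast
  then obtain p where "\<And>j. j < m \<Longrightarrow> p j \<in> polys n"
      "\<And>j x. j < m \<Longrightarrow> mpoly_eval (p j) x = F (($) x) j" by metis
  thus ?thesis unfolding morphism_def using assms(2) by (intro conjI exI[of _ p]) auto
qed

lemma variety_prod_principal_open:
  assumes h: "polyfun d h"
  shows "variety_prod (principal_open d h) (principal_open d h) =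
    {w \<in> carrier_vec (Suc d + Suc d). h (($) w) * w $ d = 1 \<and>
        h (\<lambda>i. w $ (Suc d + i)) * w $ (Suc d + d) = 1}" (is "?L = ?R")
proof (intro equalityI subsetI)
  fix w assume "w \<in> ?L"
  then obtain x y where w: "w = x @\<^sub>v y" and xy: "x \<in> principal_open d h" "y \<in> principal_open d h"
    by (auto simp: variety_prod_def)
  hence c: "x \<in> carrier_vec (Suc d)" "y \<in> carrier_vec (Suc d)" by (auto simp: principal_open_def)
  have "h (($) w) = h (($) x)" "h (\<lambda>i. w $ (Suc d + i)) = h (($) y)"
    by (rule polyfun_cong_arg[OF h]; use c w in simp)+
  moreover have "w \<in> carrier_vec (Suc d + Suc d)" unfolding w using c by (rule append_carrier_vec)
  ultimately show "w \<in> ?R" using xy c w by (auto simp: principal_open_def)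
next
  fix w assume w: "w \<in> ?R"
  let ?x = "vec (Suc d) (($) w)" and ?y = "vec (Suc d) (\<lambda>i. w $ (Suc d + i))"
  have "h (($) ?x) = h (($) w)" "h (($) ?y) = h (\<lambda>i. w $ (Suc d + i))"
    by (rule polyfun_cong_arg[OF h]; simp)+
  hence "?x \<in> principal_open d h" "?y \<in> principal_open d h"
    using w by (auto simp: principal_open_def)
  moreover have "w = ?x @\<^sub>v ?y"
    using w by (intro eq_vecI) auto
  ultimately show "w \<in> ?L" unfolding variety_prod_def by blast
qed

text \<open>The coordinates \<open>x\<close> and \<open>u\<close> of the introduction have the indices \<open>0\<close> and \<open>1\<close>.\<close>

definition twist_poly :: "nat \<Rightarrow> (nat \<Rightarrow> complex) \<Rightarrow> complex" where
  "twist_poly a y = y 1 * (y 1 ^ a + y 0 ^ 5)"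

lemma polyfun_twist_poly: "d \<ge> 2 \<Longrightarrow> polyfun d (twist_poly a)"
  unfolding twist_poly_def by (intro polyfun_intros) auto

abbreviation twisted :: "nat \<Rightarrow> nat \<Rightarrow> complex vec set" where
  "twisted d a \<equiv> principal_open d (twist_poly a)"

definition twisted_coords :: "nat \<Rightarrow> (nat \<Rightarrow> complex) \<Rightarrow> twisted_pair" where
  "twisted_coords d w = (w 0, w 1, w d, w (Suc d), w (Suc d + 1), w (Suc d + d))"

definition set_twisted_coords :: "nat \<Rightarrow> twisted_pair \<Rightarrow> (nat \<Rightarrow> complex) \<Rightarrow> nat \<Rightarrow> complex" where
  "set_twisted_coords d = (\<lambda>(x, u, s, x', u', s') w.
     w(0 := x, 1 := u, d := s, Suc d := x', Suc d + 1 := u', Suc d + d := s'))"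

lemma twisted_coords_of_set: "d \<ge> 2 \<Longrightarrow> twisted_coords d (set_twisted_coords d t w) = t"
  by (cases t) (auto simp: twisted_coords_def set_twisted_coords_def)

lemma twisted_coords_vec: "d \<ge> 2 \<Longrightarrow> twisted_coords d (($) (vec (Suc d + Suc d) w)) = twisted_coords d w"
  by (auto simp: twisted_coords_def)

lemma set_twisted_coords_of: "d \<ge> 2 \<Longrightarrow> set_twisted_coords d (twisted_coords d w) (set_twisted_coords d t w) = w"
  by (cases t) (auto simp: twisted_coords_def set_twisted_coords_def fun_eq_iff)

lemma variety_prod_twisted:
  assumes "d \<ge> 2"
  shows "variety_prod (twisted d a) (twisted d a) =
    {w \<in> carrier_vec (Suc d + Suc d). on_twisted_square a (twisted_coords d (($) w))}"
  unfolding variety_prod_principal_open[OF polyfun_twist_poly[OF assms]]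
  by (auto simp: on_twisted_square_def twisted_coords_def twist_poly_def)

lemma polyfun_if:
  "(P \<Longrightarrow> polyfun n f) \<Longrightarrow> (\<not> P \<Longrightarrow> polyfun n g) \<Longrightarrow> polyfun n (\<lambda>y. if P then f y else g y)"
  by (cases P) auto

lemma polyfun_set_twisted_coords:
  assumes d: "d \<ge> 2" and j: "j < Suc d + Suc d"
  shows "polyfun (Suc d + Suc d) (\<lambda>w. set_twisted_coords d (square_map (twisted_coords d w)) w j)"
    and "polyfun (Suc d + Suc d) (\<lambda>w. set_twisted_coords d (square_map_inv (twisted_coords d w)) w j)"
  using d j
  by (auto simp: set_twisted_coords_def square_map_def square_map_inv_def twisted_coords_def Let_def fun_upd_def
      intro!: polyfun_if polyfun_intros)

lemma squares_isomorphic: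
  assumes d: "d \<ge> 2"
  shows "isomorphic (Suc d + Suc d) (variety_prod (twisted d 1) (twisted d 1))
     (Suc d + Suc d) (variety_prod (twisted d 2) (twisted d 2))"
proof -
  let ?n = "Suc d + Suc d"
  let ?f = "\<lambda>x. vec ?n (set_twisted_coords d (square_map (twisted_coords d (($) x))) (($) x))"
  let ?g = "\<lambda>x. vec ?n (set_twisted_coords d (square_map_inv (twisted_coords d (($) x))) (($) x))"
  have undo: "vec ?n (set_twisted_coords d t (($) (vec ?n (set_twisted_coords d t' (($) x))))) = x"
    if "t = twisted_coords d (($) x)" "x \<in> carrier_vec ?n" for t t' and x :: "complex vec"
  proof (rule eq_vecI)
    fix i assume "i < dim_vec x"
    hence i: "i < ?n" using that by auto
    hence "set_twisted_coords d t (($) (vec ?n (set_twisted_coords d t' (($) x)))) i = set_twisted_coords d t (set_twisted_coords d t' (($) x)) i"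
      by (cases t) (auto simp: set_twisted_coords_def)
    also have "\<dots> = x $ i" unfolding that by (simp add: set_twisted_coords_of[OF d])
    finally show "vec ?n (set_twisted_coords d t (($) (vec ?n (set_twisted_coords d t' (($) x))))) $ i = x $ i"
      using i by simp
  qed (use that in auto)
  show ?thesis
    unfolding isomorphic_def variety_prod_twisted[OF d]
  proof (intro exI conjI ballI)
    show "morphism ?n {w \<in> carrier_vec ?n. on_twisted_square 1 (twisted_coords d (($) w))} ?n
        {w \<in> carrier_vec ?n. on_twisted_square 2 (twisted_coords d (($) w))} ?f"
    proof (intro morphism_vec_polyfun polyfun_set_twisted_coords d)
      fix x assume "x \<in> {w \<in> carrier_vec ?n. on_twisted_square 1 (twisted_coords d (($) w))}"
      hence "on_twisted_square 2 (square_map (twisted_coords d (($) x)))" by (intro square_map(1)) simp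
      thus "vec ?n (set_twisted_coords d (square_map (twisted_coords d (($) x))) (($) x)) \<in>
          {w \<in> carrier_vec ?n. on_twisted_square 2 (twisted_coords d (($) w))}"
        using twisted_coords_vec[OF d] twisted_coords_of_set[OF d] by simp
    qed
    show "morphism ?n {w \<in> carrier_vec ?n. on_twisted_square 2 (twisted_coords d (($) w))} ?n
        {w \<in> carrier_vec ?n. on_twisted_square 1 (twisted_coords d (($) w))} ?g"
    proof (intro morphism_vec_polyfun polyfun_set_twisted_coords d)
      fix x assume "x \<in> {w \<in> carrier_vec ?n. on_twisted_square 2 (twisted_coords d (($) w))}"
      hence "on_twisted_square 1 (square_map_inv (twisted_coords d (($) x)))" by (intro square_map_inv(1)) simp
      thus "vec ?n (set_twisted_coords d (square_map_inv (twisted_coords d (($) x))) (($) x)) \<in>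
          {w \<in> carrier_vec ?n. on_twisted_square 1 (twisted_coords d (($) w))}"
        using twisted_coords_vec[OF d] twisted_coords_of_set[OF d] by simp
    qed
  next
    fix x assume "x \<in> {w \<in> carrier_vec ?n. on_twisted_square 1 (twisted_coords d (($) w))}"
    thus "?g (?f x) = x"
      by (intro undo)
         (simp_all only: twisted_coords_vec[OF d] twisted_coords_of_set[OF d] mem_Collect_eq square_map(2) simp_thms)
  next
    fix x assume "x \<in> {w \<in> carrier_vec ?n. on_twisted_square 2 (twisted_coords d (($) w))}"
    thus "?f (?g x) = x"
      by (intro undo)
         (simp_all only: twisted_coords_vec[OF d] twisted_coords_of_set[OF d] mem_Collect_eq square_map_inv(2) simp_thms)
  qed
qed

lemma smooth_twisted:
  assumes "d \<ge> 2"
  shows "smooth_affine_variety (Suc d) (twisted d a)" "variety_dim (Suc d) (twisted d a) = enat d"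
  by (intro smooth_principal_open[where c = "\<lambda>i. if i = 1 then 1 else 0"]
      polyfun_twist_poly assms; simp add: twist_poly_def)+

section \<open>Regular functions along curves\<close>

definition regular :: "nat \<Rightarrow> complex vec set \<Rightarrow> (complex vec \<Rightarrow> complex) \<Rightarrow> bool" where
  "regular n X g \<longleftrightarrow> (\<exists>F. polyfun n F \<and> (\<forall>x\<in>X. g x = F (($) x)))"

lemma regular_coord: "i < n \<Longrightarrow> regular n X (\<lambda>x. x $ i)"
  unfolding regular_def by (intro exI[of _ "\<lambda>y. y i"]) (auto intro: polyfun_intros)

lemma regular_add: "regular n X f \<Longrightarrow> regular n X g \<Longrightarrow> regular n X (\<lambda>x. f x + g x)"
  unfolding regular_def by (metis (no_types, lifting) polyfun.add)

lemma regular_mult: "regular n X f \<Longrightarrow> regular n X g \<Longrightarrow> regular n X (\<lambda>x. f x * g x)"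
  unfolding regular_def by (metis (no_types, lifting) polyfun.mult)

lemma regular_power: "regular n X f \<Longrightarrow> regular n X (\<lambda>x. f x ^ k)"
  unfolding regular_def by (metis (no_types, lifting) polyfun_power)

lemmas regular_intros = regular_coord regular_add regular_mult regular_power

lemma regular_comp_morphism:
  assumes f: "morphism n X m Y f" and g: "regular m Y g" and X: "X \<subseteq> carrier_vec n"
  shows "regular n X (\<lambda>x. g (f x))"
proof -
  obtain p where p: "\<And>j. j < m \<Longrightarrow> p j \<in> polys n"
      "\<And>x. x \<in> X \<Longrightarrow> f x = vec m (\<lambda>j. mpoly_eval (p j) x)" and fX: "f ` X \<subseteq> Y"
    using f unfolding morphism_def by blast
  obtain G where G: "polyfun m G" "\<And>y. y \<in> Y \<Longrightarrow> g y = G (($) y)"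
    using g unfolding regular_def by blast
  have "polyfun n (\<lambda>y. G (\<lambda>j. mpoly_eval (p j) (vec n y)))"
    by (rule polyfun_subst[OF G(1)]) (intro polyfun_of_mpoly p)
  moreover have "g (f x) = G (\<lambda>j. mpoly_eval (p j) (vec n (($) x)))" if "x \<in> X" for x
  proof -
    have "g (f x) = G (($) (f x))" using fX that by (intro G(2)) auto
    also have "\<dots> = G (\<lambda>j. mpoly_eval (p j) (vec n (($) x)))"
      by (rule polyfun_cong_arg[OF G(1)]) (use p(2)[OF that] X that in auto)
    finally show ?thesis .
  qed
  ultimately show ?thesis unfolding regular_def by blast
qed

lemma regular_on_curve:
  assumes h: "polyfun d h" and g: "regular (Suc d) (principal_open d h) g"
  shows "\<exists>N q. \<forall>t. h (\<lambda>i. poly (r i) t) \<noteq> 0 \<longrightarrow>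
      g (open_pt d h (\<lambda>i. poly (r i) t)) * h (\<lambda>i. poly (r i) t) ^ N = poly q t"
proof -
  obtain F where F: "polyfun (Suc d) F" "\<And>x. x \<in> principal_open d h \<Longrightarrow> g x = F (($) x)"
    using g unfolding regular_def by blast
  obtain N G where G: "polyfun d G" "\<And>y. h y \<noteq> 0 \<Longrightarrow> F (($) (open_pt d h y)) * h y ^ N = G y"
    using clear_denominators[OF F(1) h] by blast
  obtain q where "\<forall>t. G (\<lambda>i. poly (r i) t) = poly q t" using polyfun_on_curve[OF G(1)] by blast
  thus ?thesis
    using F(2)[OF open_pt_in_principal_open[OF h]] G(2) by (intro exI[of _ N] exI[of _ q]) auto
qed

lemma regular_DERIV_on_curve:
  assumes h: "polyfun d h" and g: "regular (Suc d) (principal_open d h) g"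
    and nz: "h (\<lambda>i. poly (r i) z) \<noteq> 0"
  shows "\<exists>D. ((\<lambda>t. g (open_pt d h (\<lambda>i. poly (r i) t))) has_field_derivative D) (at z)"
proof -
  obtain N q where q: "\<forall>t. h (\<lambda>i. poly (r i) t) \<noteq> 0 \<longrightarrow>
      g (open_pt d h (\<lambda>i. poly (r i) t)) * h (\<lambda>i. poly (r i) t) ^ N = poly q t"
    using regular_on_curve[OF h g, of r] by blast
  obtain k where k: "\<forall>t. h (\<lambda>i. poly (r i) t) = poly k t" using polyfun_on_curve[OF h] by blast
  let ?D = "(poly (pderiv q) z * poly (k ^ N) z - poly q z * poly (pderiv (k ^ N)) z) /
     (poly (k ^ N) z * poly (k ^ N) z)"
  have "((\<lambda>t. poly q t / poly (k ^ N) t) has_field_derivative ?D) (at z)"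
    using nz k by (intro DERIV_divide poly_DERIV) auto
  hence "((\<lambda>t. g (open_pt d h (\<lambda>i. poly (r i) t))) has_field_derivative ?D) (at z)"
  proof (rule has_field_derivative_transform_within_open)
    show "open {t. poly k t \<noteq> 0}" by (intro open_Collect_neq continuous_intros)
    show "poly q t / poly (k ^ N) t = g (open_pt d h (\<lambda>i. poly (r i) t))" if "t \<in> {t. poly k t \<noteq> 0}" for t
      using q[rule_format, of t] k that by (simp add: divide_eq_eq)
  qed (use nz k in simp)
  thus ?thesis by blast
qed

text \<open>Linear factors of a product are distributed over the two factors. It is stated over a domain, since
  it is used for univariate polynomials with coefficients in \<open>\<complex>\<close> and in \<open>\<complex>[x]\<close>.\<close>

lemma extract_root_power:
  fixes F G H :: "'a :: idom poly"
  assumes "F * G = [:- a, 1:] ^ m * H"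
  shows "\<exists>i F' G'. F = [:- a, 1:] ^ i * F' \<and> F' * G' = H"
  using assms
proof (induction m arbitrary: F G)
  case 0
  thus ?case by (intro exI[of _ 0] exI[of _ F] exI[of _ G]) simp
next
  case (Suc m)
  have "poly F a * poly G a = poly ([:- a, 1:] ^ Suc m * H) a"
    by (simp only: poly_mult[symmetric] Suc.prems)
  hence "poly F a = 0 \<or> poly G a = 0" by simp
  thus ?case
  proof
    assume "poly F a = 0"
    then obtain K where K: "F = [:- a, 1:] * K" by (auto simp: poly_eq_0_iff_dvd elim: dvdE)
    have "[:- a, 1:] * (K * G) = [:- a, 1:] * ([:- a, 1:] ^ m * H)"
      using Suc.prems by (simp only: K power_Suc mult.assoc)
    hence "K * G = [:- a, 1:] ^ m * H" by (subst (asm) mult_cancel_left) simp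
    from Suc.IH[OF this] obtain i F' G' where "K = [:- a, 1:] ^ i * F'" "F' * G' = H" by blast
    thus ?thesis by (intro exI[of _ "Suc i"] exI[of _ F'] exI[of _ G']) (simp only: K power_Suc mult.assoc)
  next
    assume "poly G a = 0"
    then obtain K where K: "G = [:- a, 1:] * K" by (auto simp: poly_eq_0_iff_dvd elim: dvdE)
    have "[:- a, 1:] * (F * K) = [:- a, 1:] * ([:- a, 1:] ^ m * H)"
      using Suc.prems by (simp only: K power_Suc mult.assoc mult.left_commute)
    hence "F * K = [:- a, 1:] ^ m * H" by (subst (asm) mult_cancel_left) simp
    from Suc.IH[OF this] show ?thesis .
  qed
qed

lemma poly_unit_times_root_powers:
  fixes F G :: "'a :: idom poly"
  assumes "F * G = [:- a, 1:] ^ m * ([:- b, 1:] ^ k * [:e:])" "e dvd 1"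
  shows "\<exists>i j c. F = [:- a, 1:] ^ i * ([:- b, 1:] ^ j * [:c:]) \<and> c dvd 1"
proof -
  obtain i F1 G1 where 1: "F = [:- a, 1:] ^ i * F1" "F1 * G1 = [:- b, 1:] ^ k * [:e:]"
    using extract_root_power[OF assms(1)] by blast
  obtain j F2 G2 where 2: "F1 = [:- b, 1:] ^ j * F2" "F2 * G2 = [:e:]"
    using extract_root_power[OF 1(2)] by blast
  have "F2 dvd [:e:]" using 2(2) by (metis dvd_triv_left)
  moreover have "[:e:] dvd 1" using assms(2) by (simp add: is_unit_const_poly_iff)
  ultimately have "F2 dvd 1" by (rule dvd_trans)
  then obtain c where "F2 = [:c:]" "c dvd 1" by (auto simp: is_unit_poly_iff)
  thus ?thesis using 1 2 by blast
qed

text \<open>Along a polynomial curve on which \<open>h\<close> is constant there are no denominators, so a unit restricts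
  to an invertible univariate polynomial.\<close>

lemma regular_unit_on_curve_const:
  assumes h: "polyfun d h" and g: "regular (Suc d) (principal_open d h) g"
    "regular (Suc d) (principal_open d h) g'"
    and unit: "\<And>x. x \<in> principal_open d h \<Longrightarrow> g x * g' x = 1"
    and const: "\<And>t. h (\<lambda>i. poly (r i) t) = H" "H \<noteq> 0"
  shows "g (open_pt d h (\<lambda>i. poly (r i) s)) = g (open_pt d h (\<lambda>i. poly (r i) t))"
proof -
  obtain N q where q: "\<And>t. g (open_pt d h (\<lambda>i. poly (r i) t)) * H ^ N = poly q t"
    using regular_on_curve[OF h g(1), of r] const by auto
  obtain M p where p: "\<And>t. g' (open_pt d h (\<lambda>i. poly (r i) t)) * H ^ M = poly p t"
    using regular_on_curve[OF h g(2), of r] const by auto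
  have "poly (q * p) t = poly [:H ^ (N + M):] t" for t
  proof -
    have "g (open_pt d h (\<lambda>i. poly (r i) t)) * g' (open_pt d h (\<lambda>i. poly (r i) t)) = 1"
      by (intro unit open_pt_in_principal_open h) (simp add: const)
    thus ?thesis by (simp add: q[symmetric] p[symmetric] power_add mult_ac)
  qed
  hence "poly (q * p) = poly [:H ^ (N + M):]" by (rule ext)
  hence qp: "q * p = [:H ^ (N + M):]" by (simp only: poly_eq_poly_eq_iff)
  hence "q dvd [:H ^ (N + M):]" by (metis dvd_triv_left)
  moreover have "[:H ^ (N + M):] dvd 1" using const(2) by (simp add: is_unit_const_poly_iff dvd_field_iff)
  ultimately have "q dvd 1" by (rule dvd_trans)
  then obtain c where "q = [:c:]" by (auto simp: is_unit_poly_iff)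
  hence "g (open_pt d h (\<lambda>i. poly (r i) s)) * H ^ N = g (open_pt d h (\<lambda>i. poly (r i) t)) * H ^ N"
    by (simp add: q)
  thus ?thesis using const(2) by simp
qed

section \<open>Units of the first variety\<close>

definition plane_pt :: "complex \<Rightarrow> complex \<Rightarrow> nat \<Rightarrow> complex" where
  "plane_pt x u i = (if i = 0 then x else if i = 1 then u else 0)"

lemma plane_pt_simps [simp]:
  "plane_pt x u 0 = x" "plane_pt x u (Suc 0) = u" "twist_poly a (plane_pt x u) = u * (u ^ a + x ^ 5)"
  by (auto simp: plane_pt_def twist_poly_def)

abbreviation twisted_pt :: "nat \<Rightarrow> nat \<Rightarrow> complex \<Rightarrow> complex \<Rightarrow> complex vec" where
  "twisted_pt d a x u \<equiv> open_pt d (twist_poly a) (plane_pt x u)"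

lemma twisted_pt_in:
  "d \<ge> 2 \<Longrightarrow> u \<noteq> 0 \<Longrightarrow> u ^ a + x ^ 5 \<noteq> 0 \<Longrightarrow> twisted_pt d a x u \<in> twisted d a"
  by (intro open_pt_in_principal_open polyfun_twist_poly) auto

lemma twistedD:
  assumes "x \<in> twisted d a"
  shows "x $ 1 \<noteq> 0" "x $ 1 ^ a + x $ 0 ^ 5 \<noteq> 0" "x $ 1 * (x $ 1 ^ a + x $ 0 ^ 5) * x $ d = 1"
  using assms by (auto simp: principal_open_def twist_poly_def)

lemma polyfun_on_plane:
  assumes "polyfun n f"
  shows "\<exists>F. \<forall>x u. f (plane_pt x u) = poly (poly F [:u:]) x"
  using assms
proof induction
  case (const c)
  show ?case by (intro exI[of _ "[:[:c:]:]"]) auto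
next
  case (coord i)
  consider "i = 0" | "i = 1" | "i \<noteq> 0" "i \<noteq> 1" by blast
  thus ?case
  proof cases
    case 1 thus ?thesis by (intro exI[of _ "[:[:0, 1:]:]"]) (auto simp: plane_pt_def)
  next
    case 2 thus ?thesis by (intro exI[of _ "[:0, 1:]"]) (auto simp: plane_pt_def)
  next
    case 3 thus ?thesis by (intro exI[of _ 0]) (auto simp: plane_pt_def)
  qed
next
  case (add f g)
  thus ?case by (metis poly_add)
next
  case (mult f g)
  thus ?case by (metis poly_mult)
qed

text \<open>Bivariate polynomials are elements of \<open>\<complex>[x][u]\<close>: the inner evaluation puts the constant \<open>u\<close>
  for the outer variable.\<close>

lemma poly_poly_eqI:
  fixes F G :: "complex poly poly"
  assumes "\<And>x u. u \<noteq> 0 \<Longrightarrow> u + x ^ 5 \<noteq> 0 \<Longrightarrow> poly (poly F [:u:]) x = poly (poly G [:u:]) x"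
  shows "F = G"
proof -
  define D where "D = (F - G) * ([:0, 1:] * [:monom 1 5, 1:])"
  have "poly (poly D [:u:]) x =
      (poly (poly F [:u:]) x - poly (poly G [:u:]) x) * (u * (u + x ^ 5))" for u x
    by (simp add: D_def poly_monom algebra_simps)
  hence "poly (poly D [:u:]) x = 0" for u x
    using assms[of u x] by (cases "u = 0 \<or> u + x ^ 5 = 0") auto
  hence "poly D [:u:] = 0" for u by (subst poly_all_0_iff_0[symmetric]) blast
  hence "range (\<lambda>u. [:u:]) \<subseteq> {p. poly D p = 0}" by auto
  moreover have "infinite (range (\<lambda>u::complex. [:u:]))"
    by (subst finite_image_iff) (auto simp: inj_on_def infinite_UNIV_char_0)
  ultimately have "D = 0" using poly_roots_finite[of D] finite_subset by blast
  thus ?thesis unfolding D_def mult_eq_0_iff by auto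
qed

text \<open>On the plane \<open>z = 0\<close> a unit and its inverse give a factorization of a power of \<open>u (u + x\<^sup>5)\<close> in
  \<open>\<complex>[x][u]\<close>, where both factors are linear in \<open>u\<close>, hence prime. The value at other points is the
  same because a unit is constant along the lines in direction \<open>z\<close>.\<close>

lemma regular_unit_twisted:
  assumes d: "d \<ge> 2" and g: "regular (Suc d) (twisted d 1) g" "regular (Suc d) (twisted d 1) g'"
    and unit: "\<And>x. x \<in> twisted d 1 \<Longrightarrow> g x * g' x = 1"
  shows "\<exists>c i j. c \<noteq> 0 \<and> (\<forall>x\<in>twisted d 1. g x = c * x $ 1 powi i * (x $ 1 + x $ 0 ^ 5) powi j)"
proof -
  have h: "polyfun d (twist_poly 1)" by (rule polyfun_twist_poly[OF d])
  let ?ev = "\<lambda>F x u. poly (poly F [:u:]) x :: complex"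
  have "\<exists>N F. \<forall>x u. u \<noteq> 0 \<longrightarrow> u + x ^ 5 \<noteq> 0 \<longrightarrow> f (twisted_pt d 1 x u) * (u * (u + x ^ 5)) ^ N = ?ev F x u"
    if f: "regular (Suc d) (twisted d 1) f" for f
  proof -
    obtain F where F: "polyfun (Suc d) F" "\<And>x. x \<in> twisted d 1 \<Longrightarrow> f x = F (($) x)"
      using f unfolding regular_def by blast
    obtain N G where G: "polyfun d G"
        "\<And>y. twist_poly 1 y \<noteq> 0 \<Longrightarrow> F (($) (open_pt d (twist_poly 1) y)) * twist_poly 1 y ^ N = G y"
      using clear_denominators[OF F(1) h] by blast
    obtain K where K: "\<forall>x u. G (plane_pt x u) = ?ev K x u" using polyfun_on_plane[OF G(1)] by blast
    have "f (twisted_pt d 1 x u) * (u * (u + x ^ 5)) ^ N = ?ev K x u" if "u \<noteq> 0" "u + x ^ 5 \<noteq> 0" for x u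
      using G(2)[of "plane_pt x u"] K that F(2)[OF twisted_pt_in[OF d, of u 1 x]] by simp
    thus ?thesis by blast
  qed
  from this[OF g(1)] this[OF g(2)] obtain N F M G where
    F: "\<And>x u. u \<noteq> 0 \<Longrightarrow> u + x ^ 5 \<noteq> 0 \<Longrightarrow> g (twisted_pt d 1 x u) * (u * (u + x ^ 5)) ^ N = ?ev F x u" and
    G: "\<And>x u. u \<noteq> 0 \<Longrightarrow> u + x ^ 5 \<noteq> 0 \<Longrightarrow> g' (twisted_pt d 1 x u) * (u * (u + x ^ 5)) ^ M = ?ev G x u"
    by blast
  let ?b = "- monom 1 5 :: complex poly"
  have FG: "F * G = [:- 0, 1:] ^ (N + M) * ([:- ?b, 1:] ^ (N + M) * [:1:])"
  proof (rule poly_poly_eqI)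
    fix x u :: complex assume xu: "u \<noteq> 0" "u + x ^ 5 \<noteq> 0"
    have "?ev (F * G) x u = g (twisted_pt d 1 x u) * g' (twisted_pt d 1 x u) * (u * (u + x ^ 5)) ^ (N + M)"
      by (simp add: F[OF xu, symmetric] G[OF xu, symmetric] power_add mult_ac)
    also have "\<dots> = (u * (u + x ^ 5)) ^ (N + M)"
      using unit[OF twisted_pt_in[OF d, of u 1 x]] xu by simp
    also have "\<dots> = ?ev ([:- 0, 1:] ^ (N + M) * ([:- ?b, 1:] ^ (N + M) * [:1:])) x u"
      by (simp add: poly_power poly_monom power_mult_distrib add.commute)
    finally show "?ev (F * G) x u = \<dots>" .
  qed
  then obtain i j k where F_eq: "F = [:- 0, 1:] ^ i * ([:- ?b, 1:] ^ j * [:k:])" and "k dvd 1"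
    using poly_unit_times_root_powers[OF FG dvd_refl] by blast
  then obtain c where c: "k = [:c:]" "c dvd 1" unfolding is_unit_poly_iff by blast
  hence "c \<noteq> 0" by auto
  have plane: "g (twisted_pt d 1 x u) = c * u powi (int i - int N) * (u + x ^ 5) powi (int j - int N)"
    if xu: "u \<noteq> 0" "u + x ^ 5 \<noteq> 0" for x u
  proof -
    have "g (twisted_pt d 1 x u) * (u * (u + x ^ 5)) ^ N = c * u ^ i * (u + x ^ 5) ^ j"
      unfolding F[OF xu] F_eq c(1) by (simp add: poly_power poly_monom add.commute mult_ac)
    hence "g (twisted_pt d 1 x u) = c * u ^ i * (u + x ^ 5) ^ j / (u * (u + x ^ 5)) ^ N"
      using xu by (subst eq_divide_eq) simp
    thus ?thesis using xu by (simp add: power_int_diff power_mult_distrib)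
  qed
  have "g x = c * x $ 1 powi (int i - int N) * (x $ 1 + x $ 0 ^ 5) powi (int j - int N)"
    if x: "x \<in> twisted d 1" for x
  proof -
    define r where "r = (\<lambda>i. if i < 2 then [:x $ i:] else [:0, x $ i:])"
    have r: "twist_poly 1 (\<lambda>i. poly (r i) t) = x $ 1 * (x $ 1 + x $ 0 ^ 5)" for t
      by (simp add: r_def twist_poly_def)
    have "g (open_pt d (twist_poly 1) (\<lambda>i. poly (r i) 1)) = g (open_pt d (twist_poly 1) (\<lambda>i. poly (r i) 0))"
      using twistedD[OF x] by (intro regular_unit_on_curve_const[OF h g unit r]) auto
    moreover have "(\<lambda>i. poly (r i) 1) = ($) x"
      by (auto simp: r_def)
    moreover have "(\<lambda>i. poly (r i) 0) = plane_pt (x $ 0) (x $ 1)"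
      by (auto simp: r_def plane_pt_def fun_eq_iff less_2_cases_iff)
    moreover have "x = open_pt d (twist_poly 1) (($) x)" using principal_openE[OF x] by blast
    ultimately have "g x = g (twisted_pt d 1 (x $ 0) (x $ 1))" by simp
    thus ?thesis using plane[of "x $ 1" "x $ 0"] twistedD[OF x] by simp
  qed
  thus ?thesis using \<open>c \<noteq> 0\<close> by blast
qed

section \<open>Differences of monomials that are fifth powers\<close>

lemma DERIV_monomial:
  fixes u v :: "complex \<Rightarrow> complex"
  assumes "(u has_field_derivative u') (at z)" "(v has_field_derivative v') (at z)" "u z \<noteq> 0" "v z \<noteq> 0"
  shows "((\<lambda>t. c * u t powi i * v t powi j) has_field_derivative
     c * u z powi i * v z powi j * (of_int i * u' / u z + of_int j * v' / v z)) (at z)"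
proof -
  have u: "((\<lambda>t. u t powi i) has_field_derivative of_int i * u z powi (i - 1) * u') (at z)"
    and v: "((\<lambda>t. v t powi j) has_field_derivative of_int j * v z powi (j - 1) * v') (at z)"
    using assms by (auto intro: DERIV_power_int)
  have "u z powi (i - 1) = u z powi i / u z" "v z powi (j - 1) = v z powi j / v z"
    using assms(3,4) by (simp_all add: power_int_diff)
  thus ?thesis
    using DERIV_mult[OF DERIV_cmult[OF u, of c] v] by (simp add: algebra_simps)
qed

lemma ex_power_int_eq:
  fixes w :: complex
  assumes "w \<noteq> 0" "q \<noteq> 0"
  shows "\<exists>v. v \<noteq> 0 \<and> v powi q = w"
proof -
  have pos: "\<exists>v. v \<noteq> 0 \<and> v ^ n = w" if "w \<noteq> 0" "n > 0" for n and w :: complex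
  proof -
    have "degree (monom 1 n + [:- w:]) = n"
      using that by (subst degree_add_eq_left) (auto simp: degree_monom_eq)
    hence "\<not> constant (poly (monom 1 n + [:- w:]))"
      using that by (subst constant_degree) simp
    then obtain v where "poly (monom 1 n + [:- w:]) v = 0"
      using fundamental_theorem_of_algebra by blast
    hence "v ^ n = w" by (simp add: poly_monom)
    thus ?thesis using that by (intro exI[of _ v]) auto
  qed
  show ?thesis
  proof (cases "q > 0")
    case True
    thus ?thesis using pos[of w "nat q"] assms by (auto simp: power_int_def)
  next
    case False
    thus ?thesis using pos[of "inverse w" "nat (- q)"] assms
      by (auto simp: power_int_def power_inverse)
  qed
qed

lemma ex_fifth_root: "\<exists>x::complex. x ^ 5 = w"
  using ex_power_int_eq[of w 5] by (cases "w = 0") (auto intro: exI[of _ 0])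

lemma nontrivial_root_of_unity:
  fixes q :: int
  assumes "q \<noteq> 0" "\<And>v::complex. v \<noteq> 0 \<Longrightarrow> v powi q = 1 \<Longrightarrow> v = 1"
  shows "\<bar>q\<bar> = 1"
proof -
  define n where "n = nat \<bar>q\<bar>"
  have n: "n > 0" using assms(1) by (simp add: n_def)
  have "{z::complex. z ^ n = 1} \<subseteq> {1}"
  proof
    fix z :: complex assume "z \<in> {z. z ^ n = 1}"
    hence z: "z ^ n = 1" "z \<noteq> 0" using n by (auto simp: zero_power)
    have "z powi q = 1"
      using z by (cases "q > 0") (auto simp: power_int_def n_def power_inverse)
    thus "z \<in> {1}" using assms(2)[OF z(2)] by simp
  qed
  hence "card {z::complex. z ^ n = 1} \<le> card {1 :: complex}" by (rule card_mono[rotated]) simp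
  thus ?thesis using card_roots_unity_eq[OF n] n by (simp add: n_def)
qed

text \<open>A comparison of degrees, after multiplication by a power of \<open>u (u + 1)\<close> that makes all exponents
  nonnegative.\<close>

lemma fifth_power_exponents:
  fixes A :: "complex poly"
  assumes "\<kappa> \<noteq> 0"
    and eq: "\<And>u. u \<noteq> 0 \<Longrightarrow> u + 1 \<noteq> 0 \<Longrightarrow>
      poly A u ^ 5 = \<kappa> * u powi \<alpha> * (u + 1) powi \<beta> * (u * (u + 1)) ^ (5 * N)"
  shows "5 dvd \<alpha> + \<beta>"
proof -
  define M where "M = nat \<bar>\<alpha>\<bar> + nat \<bar>\<beta>\<bar>"
  define a where "a = nat (\<alpha> + 5 * int M + 5 * int N)"
  define b where "b = nat (\<beta> + 5 * int M + 5 * int N)"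
  have a: "int a = \<alpha> + 5 * int M + 5 * int N" and b: "int b = \<beta> + 5 * int M + 5 * int N"
    by (auto simp: a_def b_def M_def)
  define L where "L = [:0, 1 :: complex:]"
  define L' where "L' = [:1, 1 :: complex:]"
  define B where "B = A * (L * L') ^ M"
  have L: "poly L u = u" "poly L' u = u + 1" for u by (auto simp: L_def L'_def)
  have "poly (B ^ 5 * (L * L')) u = poly (smult \<kappa> (L ^ Suc a * L' ^ Suc b)) u" for u
  proof (cases "u = 0 \<or> u + 1 = 0")
    case True
    thus ?thesis by (auto simp: L)
  next
    case False
    have "u ^ a = u powi \<alpha> * u ^ (5 * M) * u ^ (5 * N)"
         "(u + 1) ^ b = (u + 1) powi \<beta> * (u + 1) ^ (5 * M) * (u + 1) ^ (5 * N)"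
      using False power_int_of_nat[of u a] power_int_of_nat[of "u + 1" b]
      by (simp_all add: a b power_int_add flip: power_int_of_nat)
    thus ?thesis using False
      by (simp add: B_def L power_mult_distrib eq flip: power_mult) (simp add: mult_ac)
  qed
  hence "poly (B ^ 5 * (L * L')) = poly (smult \<kappa> (L ^ Suc a * L' ^ Suc b))" by (rule ext)
  hence id: "B ^ 5 * (L * L') = smult \<kappa> (L ^ Suc a * L' ^ Suc b)" by (simp only: poly_eq_poly_eq_iff)
  have nz: "L \<noteq> 0" "L' \<noteq> 0" and deg: "degree L = 1" "degree L' = 1" by (auto simp: L_def L'_def)
  have "B \<noteq> 0" using id nz assms(1) by auto
  hence "5 * degree B + 2 = degree (B ^ 5 * (L * L'))"
    using nz by (simp add: degree_mult_eq degree_power_eq deg)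
  also have "\<dots> = Suc a + Suc b"
    unfolding id using nz assms(1) by (simp add: degree_mult_eq degree_power_eq deg del: power_Suc)
  finally have "int a + int b = 5 * int (degree B)" by simp
  hence "\<alpha> + \<beta> = 5 * (int (degree B) - 2 * int M - 2 * int N)" unfolding a b by simp
  thus ?thesis by simp
qed

text \<open>At a zero of a fifth power both partial derivatives vanish. For a difference of two monomials in
  \<open>u\<close> and \<open>v = u + x\<^sup>5\<close> they are computed by logarithmic differentiation, with the common value of
  the monomials as a factor.\<close>

lemma fifth_power_critical:
  fixes r :: "nat \<Rightarrow> complex poly" and P :: "complex vec \<Rightarrow> complex"
  assumes d: "d \<ge> 2" and P: "regular (Suc d) (twisted d 1) P" and ec: "e \<noteq> 0"
    and P5: "\<And>x. x \<in> twisted d 1 \<Longrightarrow> P x ^ 5 =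
      e * x $ 1 powi k * (x $ 1 + x $ 0 ^ 5) powi l - c * x $ 1 powi i * (x $ 1 + x $ 0 ^ 5) powi j"
    and nz: "u \<noteq> 0" "u + x ^ 5 \<noteq> 0"
    and zero: "e * u powi k * (u + x ^ 5) powi l = c * u powi i * (u + x ^ 5) powi j"
  shows "of_int (l - j) * x = 0" "of_int (k - i) * (u + x ^ 5) + of_int (l - j) * u = 0"
proof -
  define Q where "Q = e * u powi k * (u + x ^ 5) powi l"
  have Q: "Q \<noteq> 0" "c * u powi i * (u + x ^ 5) powi j = Q" using nz ec zero by (auto simp: Q_def)
  have h: "polyfun d (twist_poly 1)" by (rule polyfun_twist_poly[OF d])
  have crit: "of_int (k - i) * a' / u + of_int (l - j) * (a' + b') / (u + x ^ 5) = 0"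
    if r: "\<And>t. (\<lambda>i. poly (r i) t) = plane_pt (X t) (U t)"
      and d': "(U has_field_derivative a') (at z)" "((\<lambda>t. X t ^ 5) has_field_derivative b') (at z)"
      and z: "U z = u" "X z = x"
    for r :: "nat \<Rightarrow> complex poly" and X U a' b' z
  proof -
    let ?V = "\<lambda>t. U t + X t ^ 5"
    have V: "(?V has_field_derivative (a' + b')) (at z)" by (intro DERIV_add d')
    define r0 where "r0 = r 0"
    define r1 where "r1 = r 1"
    have X_eq: "X t = poly r0 t" and U_eq: "U t = poly r1 t" for t
      using fun_cong[OF r[of t], of 0] fun_cong[OF r[of t], of 1] by (auto simp: r0_def r1_def)
    obtain D where "((\<lambda>t. P (open_pt d (twist_poly 1) (\<lambda>i. poly (r i) t))) has_field_derivative D) (at z)"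
      using regular_DERIV_on_curve[OF h P, of r z] nz z by (auto simp: r)
    hence D: "((\<lambda>t. P (twisted_pt d 1 (X t) (U t))) has_field_derivative D) (at z)" by (simp only: r)
    have P5': "P (twisted_pt d 1 (X t) (U t)) ^ 5 =
        e * U t powi k * ?V t powi l - c * U t powi i * ?V t powi j"
      if "U t \<noteq> 0" "?V t \<noteq> 0" for t
      using P5[OF twisted_pt_in[OF d, of "U t" 1 "X t"]] that d by simp
    have "P (twisted_pt d 1 (X z) (U z)) ^ 5 = 0" using P5'[of z] zero nz z by simp
    hence "((\<lambda>t. P (twisted_pt d 1 (X t) (U t)) ^ 5) has_field_derivative 0) (at z)"
      using DERIV_power[OF D, of 5] by simp
    hence "((\<lambda>t. e * U t powi k * ?V t powi l - c * U t powi i * ?V t powi j) has_field_derivative 0) (at z)"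
    proof (rule has_field_derivative_transform_within_open)
      show "open {t. poly r1 t * (poly r1 t + poly r0 t ^ 5) \<noteq> 0}"
        by (intro open_Collect_neq continuous_intros)
      show "P (twisted_pt d 1 (X t) (U t)) ^ 5 = e * U t powi k * ?V t powi l - c * U t powi i * ?V t powi j"
        if "t \<in> {t. poly r1 t * (poly r1 t + poly r0 t ^ 5) \<noteq> 0}" for t
        by (rule P5') (use that in \<open>simp_all add: X_eq U_eq\<close>)
    qed (use nz z in \<open>auto simp flip: X_eq U_eq\<close>)
    moreover have "((\<lambda>t. e * U t powi k * ?V t powi l - c * U t powi i * ?V t powi j) has_field_derivative
        e * U z powi k * ?V z powi l * (of_int k * a' / U z + of_int l * (a' + b') / ?V z) -
        c * U z powi i * ?V z powi j * (of_int i * a' / U z + of_int j * (a' + b') / ?V z)) (at z)"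
      using nz z by (intro DERIV_diff DERIV_monomial d'(1) V) auto
    ultimately have "0 = Q * (of_int k * a' / u + of_int l * (a' + b') / (u + x ^ 5)) -
        Q * (of_int i * a' / u + of_int j * (a' + b') / (u + x ^ 5))"
      unfolding z Q(2) Q_def[symmetric] by (rule DERIV_unique)
    also have "\<dots> = Q * (of_int (k - i) * a' / u + of_int (l - j) * (a' + b') / (u + x ^ 5))"
      by (simp add: algebra_simps diff_divide_distrib add_divide_distrib)
    finally show ?thesis using Q(1) by simp
  qed
  have "of_int (k - i) * 0 / u + of_int (l - j) * (0 + 5 * x ^ 4) / (u + x ^ 5) = 0"
    by (rule crit[of "\<lambda>i. if i = 0 then [:0, 1:] else if i = 1 then [:u:] else 0" "\<lambda>t. t" "\<lambda>t. u" 0 x])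
       (auto intro!: derivative_eq_intros simp: plane_pt_def fun_eq_iff)
  thus "of_int (l - j) * x = 0" using nz by auto
  have "of_int (k - i) * 1 / u + of_int (l - j) * (1 + 0) / (u + x ^ 5) = 0"
    by (rule crit[of "\<lambda>i. if i = 0 then [:x:] else if i = 1 then [:0, 1:] else 0" "\<lambda>t. x" "\<lambda>t. t" 1 u])
       (auto intro!: derivative_eq_intros simp: plane_pt_def fun_eq_iff)
  hence "of_int (k - i) / u + of_int (l - j) / (u + x ^ 5) = 0" by simp
  hence "(of_int (k - i) * (u + x ^ 5) + of_int (l - j) * u) / (u * (u + x ^ 5)) = 0"
    unfolding add_frac_eq[OF nz] .
  thus "of_int (k - i) * (u + x ^ 5) + of_int (l - j) * u = 0"
    using nz by simp
qed

text \<open>This applies to the pullbacks of \<open>X\<close>, \<open>V\<close> and \<open>U\<^sup>2\<close> under a morphism to the second variety. Put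
  \<open>p = k - 2 i\<close> and \<open>q = l - 2 j\<close>. All values of \<open>(u, v)\<close> with nonzero entries are attained, so
  every solution of \<open>u\<^sup>p v\<^sup>q = c / e\<close> is critical, which gives \<open>u = v\<close> and \<open>p + q = 0\<close>. In
  particular \<open>1\<close> is the only \<open>q\<close>-th root of unity, and \<open>q = \<plusminus>1\<close>. The right-hand side is then
  \<open>x\<^sup>5\<close> times a monomial of total degree \<open>2 (i + j) - 1\<close>; at \<open>x = 1\<close> it is a fifth power of a
  rational function of \<open>u\<close>.\<close>

lemma fifth_power_difference_exponents:
  assumes d: "d \<ge> 2" and P: "regular (Suc d) (twisted d 1) P" and e: "e \<noteq> 0" and c: "c \<noteq> 0"
    and P5: "\<And>x. x \<in> twisted d 1 \<Longrightarrow> P x ^ 5 =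
      e * x $ 1 powi k * (x $ 1 + x $ 0 ^ 5) powi l - c * x $ 1 powi (2 * i) * (x $ 1 + x $ 0 ^ 5) powi (2 * j)"
    and nonconst: "k \<noteq> 2 * i \<or> l \<noteq> 2 * j"
  shows "e = c" "k - 2 * i = - (l - 2 * j)" "\<bar>l - 2 * j\<bar> = 1" "5 dvd 2 * (i + j) - 1"
proof -
  define p where "p = k - 2 * i"
  define q where "q = l - 2 * j"
  have crit: "x = 0 \<or> q = 0" "of_int p * (u + x ^ 5) + of_int q * u = 0"
    if "u \<noteq> 0" "u + x ^ 5 \<noteq> 0" "u powi p * (u + x ^ 5) powi q = c / e" for u x
  proof -
    have "e * u powi k * (u + x ^ 5) powi l =
        e * (u powi p * (u + x ^ 5) powi q) * u powi (2 * i) * (u + x ^ 5) powi (2 * j)"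
      using that(1,2) by (simp add: p_def q_def power_int_diff)
    also have "\<dots> = c * u powi (2 * i) * (u + x ^ 5) powi (2 * j)"
      using that(3) e by simp
    finally have *: "e * u powi k * (u + x ^ 5) powi l = c * u powi (2 * i) * (u + x ^ 5) powi (2 * j)" .
    show "x = 0 \<or> q = 0" "of_int p * (u + x ^ 5) + of_int q * u = 0"
      using fifth_power_critical[OF d P e P5 that(1,2) *, folded p_def q_def] by auto
  qed
  have crit': "v = u \<or> q = 0" "of_int p * v + of_int q * u = 0"
    if "u \<noteq> 0" "v \<noteq> 0" "u powi p * v powi q = c / e" for u v :: complex
  proof -
    obtain x where x: "x ^ 5 = v - u" using ex_fifth_root by blast
    show "v = u \<or> q = 0" "of_int p * v + of_int q * u = 0"
      using crit[of u x] that x by auto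
  qed
  have q0: "q \<noteq> 0"
  proof
    assume q: "q = 0"
    hence p: "p \<noteq> 0" using nonconst by (auto simp: p_def q_def)
    obtain u where u: "u \<noteq> 0" "u powi p = c / e" using ex_power_int_eq[of "c / e" p] e c p by auto
    have "of_int p * (1 :: complex) + of_int q * u = 0" by (rule crit'(2)) (use u q in auto)
    thus False using p q by simp
  qed
  obtain v where v: "v \<noteq> 0" "v powi q = c / e" using ex_power_int_eq[of "c / e" q] e c q0 by auto
  have "v = 1" using crit'(1)[of 1 v] v q0 by auto
  with v have ce: "c / e = 1" by simp
  thus "e = c" using e by simp
  have "of_int p * (1 :: complex) + of_int q * 1 = 0" by (rule crit'(2)) (use ce in auto)
  hence "of_int (p + q) = (0 :: complex)" by simp
  hence pq: "p = - q" by (simp only: of_int_eq_0_iff)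
  thus "k - 2 * i = - (l - 2 * j)" by (simp add: p_def q_def)
  have q1: "\<bar>q\<bar> = 1"
    by (rule nontrivial_root_of_unity[OF q0]) (use crit'(1)[of 1] ce q0 in auto)
  thus "\<bar>l - 2 * j\<bar> = 1" by (simp add: q_def)
  define s :: complex where "s = (if q = 1 then 1 else - 1)"
  define \<alpha> where "\<alpha> = (if q = 1 then 2 * i - 1 else 2 * i)"
  define \<beta> where "\<beta> = (if q = 1 then 2 * j else 2 * j - 1)"
  have k: "k = 2 * i - q" and l: "l = 2 * j + q" using pq by (auto simp: p_def q_def)
  have q_cases: "q = 1 \<or> q = - 1" using q1 by auto
  have at1: "P (twisted_pt d 1 1 u) ^ 5 = s * c * u powi \<alpha> * (u + 1) powi \<beta>"
    if u: "u \<noteq> 0" "u + 1 \<noteq> 0" for u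
  proof -
    have "P (twisted_pt d 1 1 u) ^ 5 =
        c * u powi k * (u + 1) powi l - c * u powi (2 * i) * (u + 1) powi (2 * j)"
      using P5[OF twisted_pt_in[OF d, of u 1 1]] u d \<open>e = c\<close> by simp
    also have "\<dots> = s * c * u powi \<alpha> * (u + 1) powi \<beta>"
    proof -
      define X where "X = u powi (2 * i)"
      define w where "w = u + 1"
      define Y where "Y = w powi (2 * j)"
      have w: "w \<noteq> 0" "u = w - 1" using u by (auto simp: w_def)
      from q_cases show ?thesis
      proof
        assume "q = 1"
        thus ?thesis unfolding k l w_def[symmetric] s_def \<alpha>_def \<beta>_def using u w(1)
          by (simp add: power_int_diff power_int_add flip: X_def Y_def) (simp add: w_def field_simps)
      next
        assume "q = - 1"
        thus ?thesis unfolding k l w_def[symmetric] s_def \<alpha>_def \<beta>_def using u w(1)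
          by (simp add: power_int_diff power_int_add flip: X_def Y_def) (simp add: w(2) field_simps)
      qed
    qed
    finally show ?thesis .
  qed
  have h: "polyfun d (twist_poly 1)" by (rule polyfun_twist_poly[OF d])
  let ?r = "\<lambda>i :: nat. if i = 0 then [:1 :: complex:] else if i = 1 then [:0, 1:] else 0"
  have r: "(\<lambda>i. poly (?r i) t) = plane_pt 1 t" for t by (auto simp: plane_pt_def fun_eq_iff)
  obtain N A where A: "\<And>u. u \<noteq> 0 \<Longrightarrow> u + 1 \<noteq> 0 \<Longrightarrow>
      P (twisted_pt d 1 1 u) * (u * (u + 1)) ^ N = poly A u"
    using regular_on_curve[OF h P, of ?r] unfolding r by auto
  have "5 dvd \<alpha> + \<beta>"
  proof (rule fifth_power_exponents[of "s * c" A \<alpha> \<beta> N])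
    fix u :: complex assume u: "u \<noteq> 0" "u + 1 \<noteq> 0"
    show "poly A u ^ 5 = s * c * u powi \<alpha> * (u + 1) powi \<beta> * (u * (u + 1)) ^ (5 * N)"
      unfolding A[OF u, symmetric] power_mult_distrib[of _ "_ ^ N"] at1[OF u]
      by (simp add: mult.commute[of 5 N] power_mult)
  qed (use c in \<open>auto simp: s_def\<close>)
  thus "5 dvd 2 * (i + j) - 1"
    by (auto simp: \<alpha>_def \<beta>_def split: if_splits simp: algebra_simps)
qed

section \<open>The two varieties are not isomorphic\<close>

text \<open>On the curve \<open>(X, U) = (t\<^sup>2, t\<^sup>5)\<close> the second defining polynomial is \<open>2 t\<^sup>1\<^sup>5\<close>, so units restrict
  to Laurent monomials in \<open>t\<close>.\<close>

lemma unit_along_cuspidal_curve: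
  assumes d: "d \<ge> 2" and g: "regular (Suc d) (twisted d 2) g" "regular (Suc d) (twisted d 2) g'"
    and unit: "\<And>x. x \<in> twisted d 2 \<Longrightarrow> g x * g' x = 1"
  shows "\<exists>c m. \<forall>t. t \<noteq> 0 \<longrightarrow> g (twisted_pt d 2 (t ^ 2) (t ^ 5)) = c * t powi m"
proof -
  have h: "polyfun d (twist_poly 2)" by (rule polyfun_twist_poly[OF d])
  let ?r = "\<lambda>i :: nat. if i = 0 then monom (1 :: complex) 2 else if i = 1 then monom 1 5 else 0"
  have r: "(\<lambda>i. poly (?r i) t) = plane_pt (t ^ 2) (t ^ 5)" for t
    by (auto simp: plane_pt_def fun_eq_iff poly_monom)
  have h_eq: "twist_poly 2 (plane_pt (t ^ 2) (t ^ 5)) = 2 * t ^ 15" for t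
    by (simp add: algebra_simps flip: power_mult power_add)
  obtain N q where q: "\<And>t. t \<noteq> 0 \<Longrightarrow> g (twisted_pt d 2 (t ^ 2) (t ^ 5)) * (2 * t ^ 15) ^ N = poly q t"
    using regular_on_curve[OF h g(1), of ?r] unfolding r h_eq by auto
  obtain M q' where q': "\<And>t. t \<noteq> 0 \<Longrightarrow> g' (twisted_pt d 2 (t ^ 2) (t ^ 5)) * (2 * t ^ 15) ^ M = poly q' t"
    using regular_on_curve[OF h g(2), of ?r] unfolding r h_eq by auto
  \<comment> \<open>The extra factor \<open>t\<close> makes the identity trivial at \<open>t = 0\<close>.\<close>
  have "poly (q * (q' * [:0, 1:])) t =
      poly ([:- 0, 1:] ^ Suc (15 * (N + M)) * ([:- 0, 1:] ^ 0 * [:2 ^ (N + M):])) t" for t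
  proof (cases "t = 0")
    case False
    have "twisted_pt d 2 (t ^ 2) (t ^ 5) \<in> twisted d 2"
      using False h_eq[of t] by (intro open_pt_in_principal_open[OF h]) simp
    note * = unit[OF this]
    have "poly q t * poly q' t = (2 * t ^ 15) ^ (N + M)"
      using * by (simp add: q[OF False, symmetric] q'[OF False, symmetric] power_add mult_ac)
    thus ?thesis
      by (simp add: poly_power power_mult_distrib add_mult_distrib2 flip: power_mult)
  qed simp
  hence "poly (q * (q' * [:0, 1:])) =
      poly ([:- 0, 1:] ^ Suc (15 * (N + M)) * ([:- 0, 1:] ^ 0 * [:2 ^ (N + M):]))" by (rule ext)
  hence "q * (q' * [:0, 1:]) = [:- 0, 1:] ^ Suc (15 * (N + M)) * ([:- 0, 1:] ^ 0 * [:2 ^ (N + M):])"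
    by (simp only: poly_eq_poly_eq_iff)
  moreover have "(2 :: complex) ^ (N + M) dvd 1" by (simp add: dvd_field_iff)
  ultimately obtain i j c where qc: "q = [:- 0, 1:] ^ i * ([:- 0, 1:] ^ j * [:c:])"
    using poly_unit_times_root_powers by blast
  have "g (twisted_pt d 2 (t ^ 2) (t ^ 5)) = c / 2 ^ N * t powi (int (i + j) - int (15 * N))"
    if t: "t \<noteq> 0" for t
  proof -
    have "g (twisted_pt d 2 (t ^ 2) (t ^ 5)) * (2 * t ^ 15) ^ N = c * t ^ (i + j)"
      unfolding q[OF t] qc by (simp add: poly_power power_add mult_ac)
    hence "g (twisted_pt d 2 (t ^ 2) (t ^ 5)) = c * t ^ (i + j) / (2 * t ^ 15) ^ N"
      using t by (subst eq_divide_eq) simp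
    moreover have "t powi (int (i + j) - int (15 * N)) = t ^ (i + j) / t ^ (15 * N)"
      using t by (subst power_int_diff) (simp_all only: power_int_of_nat simp_thms)
    ultimately show ?thesis by (simp add: power_mult_distrib power_mult)
  qed
  thus ?thesis by blast
qed

text \<open>Along the cuspidal curve \<open>V / U\<^sup>2\<close> has the value \<open>2\<close>, so its preimage lies on \<open>v = 2\<^sup>\<plusminus>\<^sup>1 u\<close>, where
  the pullback of \<open>U\<close> is a constant multiple of \<open>u\<^sup>i\<^sup>+\<^sup>j\<close>. There \<open>U = t\<^sup>5\<close>, and \<open>u\<close> is a multiple
  of some \<open>t\<^sup>m\<close>, whence \<open>m (i + j) = 5\<close>.\<close>

lemma twisted_not_isomorphic:
  assumes d: "d \<ge> 2"
  shows "\<not> isomorphic (Suc d) (twisted d 1) (Suc d) (twisted d 2)"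
proof
  let ?X = "twisted d 1" and ?Y = "twisted d 2"
  assume "isomorphic (Suc d) ?X (Suc d) ?Y"
  then obtain f g where f: "morphism (Suc d) ?X (Suc d) ?Y f" and g: "morphism (Suc d) ?Y (Suc d) ?X g"
    and fg: "\<And>y. y \<in> ?Y \<Longrightarrow> f (g y) = y"
    unfolding isomorphic_def by blast
  have in_Y: "f x \<in> ?Y" if "x \<in> ?X" for x using f that unfolding morphism_def by blast
  have in_X: "g y \<in> ?X" if "y \<in> ?Y" for y using g that unfolding morphism_def by blast
  have carrier: "?X \<subseteq> carrier_vec (Suc d)" "?Y \<subseteq> carrier_vec (Suc d)"
    by (auto simp: principal_open_def)
  define V where "V = (\<lambda>y :: complex vec. y $ 1 ^ 2 + y $ 0 ^ 5)"
  have V_reg: "regular (Suc d) ?Y V" unfolding V_def by (intro regular_intros) (use d in auto)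
  have pull: "regular (Suc d) ?X (\<lambda>x. G (f x))" if "regular (Suc d) ?Y G" for G
    by (rule regular_comp_morphism[OF f that carrier(1)])
  have unit: "f x $ 1 * V (f x) * f x $ d = 1" if "x \<in> ?X" for x
    using twistedD(3)[OF in_Y[OF that]] by (simp add: V_def)
  have coord: "regular (Suc d) ?Y (\<lambda>y. y $ 1)" "regular (Suc d) ?Y (\<lambda>y. y $ d)"
    by (intro regular_coord; use d in simp)+
  have "\<exists>c i j. c \<noteq> 0 \<and> (\<forall>x\<in>?X. f x $ 1 = c * x $ 1 powi i * (x $ 1 + x $ 0 ^ 5) powi j)"
    by (rule regular_unit_twisted[OF d pull[OF coord(1)] pull[OF regular_mult[OF V_reg coord(2)]]])
       (use unit in \<open>simp only: mult_ac\<close>)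
  then obtain c i j where c: "c \<noteq> 0"
    and U: "\<And>x. x \<in> ?X \<Longrightarrow> f x $ 1 = c * x $ 1 powi i * (x $ 1 + x $ 0 ^ 5) powi j"
    by blast
  have "\<exists>c i j. c \<noteq> 0 \<and> (\<forall>x\<in>?X. V (f x) = c * x $ 1 powi i * (x $ 1 + x $ 0 ^ 5) powi j)"
    by (rule regular_unit_twisted[OF d pull[OF V_reg] pull[OF regular_mult[OF coord]]])
       (use unit in \<open>simp only: mult_ac\<close>)
  then obtain e k l where e: "e \<noteq> 0"
    and V: "\<And>x. x \<in> ?X \<Longrightarrow> V (f x) = e * x $ 1 powi k * (x $ 1 + x $ 0 ^ 5) powi l"
    by blast
  have U2: "f x $ 1 ^ 2 = c ^ 2 * x $ 1 powi (2 * i) * (x $ 1 + x $ 0 ^ 5) powi (2 * j)" if "x \<in> ?X" for x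
    unfolding U[OF that] mult.commute[of 2 i] mult.commute[of 2 j]
    by (simp add: power_mult_distrib power_int_mult)
  have P5: "f x $ 0 ^ 5 = e * x $ 1 powi k * (x $ 1 + x $ 0 ^ 5) powi l -
      c ^ 2 * x $ 1 powi (2 * i) * (x $ 1 + x $ 0 ^ 5) powi (2 * j)" if "x \<in> ?X" for x
    unfolding V[OF that, symmetric] U2[OF that, symmetric] by (simp add: V_def)
  \<comment> \<open>Otherwise \<open>V / U\<^sup>2\<close> would be constant on the second variety.\<close>
  have nonconst: "k \<noteq> 2 * i \<or> l \<noteq> 2 * j"
  proof (rule ccontr)
    assume "\<not> (k \<noteq> 2 * i \<or> l \<noteq> 2 * j)"
    hence "V (f x) = e / c ^ 2 * f x $ 1 ^ 2" if "x \<in> ?X" for x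
      unfolding V[OF that] U2[OF that] using c by simp
    hence *: "V y = e / c ^ 2 * y $ 1 ^ 2" if "y \<in> ?Y" for y
      using in_X[OF that] fg[OF that] by metis
    have "twisted_pt d 2 0 1 \<in> ?Y" "twisted_pt d 2 1 1 \<in> ?Y"
      using d by (auto intro!: twisted_pt_in)
    from this[THEN *] show False using d by (simp add: V_def)
  qed
  have P: "regular (Suc d) ?X (\<lambda>x. f x $ 0)" by (intro pull regular_intros) (use d in auto)
  have c2: "c ^ 2 \<noteq> 0" using c by simp
  note sum = fifth_power_difference_exponents[OF d P e c2 P5 nonconst]
  obtain b m where m: "\<And>t. t \<noteq> 0 \<Longrightarrow> g (twisted_pt d 2 (t ^ 2) (t ^ 5)) $ 1 = b * t powi m"
  proof -
    have "regular (Suc d) ?X (\<lambda>x. x $ 1)" "regular (Suc d) ?X (\<lambda>x. (x $ 1 + x $ 0 ^ 5) * x $ d)"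
      using d by (intro regular_intros; simp)+
    note regs = this[THEN regular_comp_morphism[OF g _ carrier(2)]]
    have "\<exists>c m. \<forall>t. t \<noteq> 0 \<longrightarrow> g (twisted_pt d 2 (t ^ 2) (t ^ 5)) $ 1 = c * t powi m"
      by (rule unit_along_cuspidal_curve[OF d regs])
         (use twistedD(3)[OF in_X] in \<open>simp add: mult.assoc\<close>)
    thus ?thesis using that by blast
  qed
  define q where "q = l - 2 * j"
  define \<mu> :: complex where "\<mu> = (if q = 1 then 2 else 1 / 2)"
  define C where "C = c * \<mu> powi j * b powi (i + j)"
  have main: "t ^ 5 = C * t powi (m * (i + j))" if t: "t \<noteq> 0" for t
  proof -
    let ?y = "twisted_pt d 2 (t ^ 2) (t ^ 5)"
    let ?x = "g ?y"
    define u where "u = ?x $ 1"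
    define v where "v = u + ?x $ 0 ^ 5"
    have y: "?y \<in> ?Y"
      using t d by (intro twisted_pt_in) (auto simp flip: power_mult)
    note x = in_X[OF y]
    have uv: "u \<noteq> 0" "v \<noteq> 0" using twistedD(1,2)[OF x] by (auto simp: u_def v_def)
    have U_t: "t ^ 5 = c * u powi i * v powi j"
      using U[OF x] fg[OF y] d by (simp add: u_def v_def)
    have "V ?y = 2 * (?y $ 1) ^ 2" using d by (simp add: V_def flip: power_mult)
    hence "c ^ 2 * u powi k * v powi l = 2 * (c ^ 2 * u powi (2 * i) * v powi (2 * j))"
      using V[OF x] U2[OF x] sum(1) unfolding fg[OF y] u_def[symmetric] v_def[symmetric] by simp
    moreover have "k = 2 * i - q" "l = 2 * j + q" using sum(2) by (auto simp: q_def)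
    ultimately have "v powi q = 2 * u powi q"
      using uv c by (simp add: power_int_add power_int_diff field_simps)
    moreover have "q = 1 \<or> q = - 1" using sum(3) unfolding q_def by linarith
    ultimately have v: "v = \<mu> * u" using uv by (auto simp: \<mu>_def power_int_minus field_simps)
    have "t ^ 5 = c * \<mu> powi j * u powi (i + j)"
      unfolding U_t v using uv by (simp add: power_int_mult_distrib power_int_add)
    also have "u = b * t powi m" unfolding u_def by (rule m[OF t])
    finally show ?thesis by (simp add: C_def power_int_mult_distrib power_int_mult)
  qed
  have "C = 1" using main[of 1] by simp
  hence "(2 :: complex) powi 5 = 2 powi (m * (i + j))" using main[of 2] by simp
  hence "norm ((2 :: complex) powi 5) = norm ((2 :: complex) powi (m * (i + j)))" by simp
  hence "(2 :: real) powi 5 = 2 powi (m * (i + j))" by (simp only: norm_power_int norm_numeral)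
  hence "m * (i + j) = 5"
    using power_int_strict_increasing[of "m * (i + j)" 5 "2 :: real"]
      power_int_strict_increasing[of 5 "m * (i + j)" "2 :: real"]
    by (cases "m * (i + j)" "5 :: int" rule: linorder_cases) auto
  hence dvd: "(i + j) dvd 5" by (intro dvdI[of _ _ m]) (simp only: mult.commute)
  have no: "\<not> 5 dvd 2 * n - 1" if n: "n dvd 5" for n :: int
  proof
    assume "5 dvd 2 * n - 1"
    then obtain k where k: "2 * n - 1 = 5 * k" by (elim dvdE)
    have "n \<le> 5" "- n \<le> 5" using zdvd_imp_le[OF n] zdvd_imp_le[of "- n" 5] n by simp_all
    hence "k = - 2 \<or> k = - 1 \<or> k = 0 \<or> k = 1" using k by linarith
    hence "n = - 2 \<or> n = 3" using k by (elim disjE; presburger)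
    thus False using n by auto
  qed
  show False using no[OF dvd] sum(4) by blast
qed

theorem mainTheorem1:
  fixes d :: nat
  assumes "d \<ge> 2"
  shows "\<exists>n X m Y.
    smooth_affine_variety n X \<and> variety_dim n X = enat d \<and>
    smooth_affine_variety m Y \<and> variety_dim m Y = enat d \<and>
    \<not> isomorphic n X m Y \<and>
    isomorphic (n + n) (variety_prod X X) (m + m) (variety_prod Y Y)"
  using smooth_twisted[OF assms] twisted_not_isomorphic[OF assms] squares_isomorphic[OF assms]
  by blast

end
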